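(* Let $\tilde\Gamma_2(x,\varepsilon)=\gamma(x)+\varepsilon\gamma_1(x)+\varepsilon^2\gamma_2(x)$, let $(x(t),y(t))$ solve $$\frac{dx}{dt}=f(x,y),\qquad \frac{dy}{dt}=\frac1\varepsilon g(x,y),\qquad x(0)=x_0,\ y(0)=y_0,$$ let $z(t)=y(t)-\tilde\Gamma_2(x(t),\varepsilon)$, and let $X_2(t)$ solve $\frac{dX_2}{dt}=f(X_2,\tilde\Gamma_2(X_2,\varepsilon))$. Then there exists a constant $C>0$ independent of $\varepsilon$ such that, for all sufficiently small $\varepsilon>0$ (and all $t\ge0$), $$|x(t)-X_2(t)|^2\le e^{Ct}\left(|x(0)-X_2(0)|^2+\varepsilon^6+\frac{\varepsilon}{\beta}|z(0)|^2\right).$$ In particular, if $|x(0)-X_2(0)|=\mathcal O(\varepsilon^3)$ and $|z(0)|=\mathcal O(\varepsilon^{5/2})$, then $|x(t)-X_2(t)|=\mathcal O(\varepsilon^3)$ for $t\sim\mathcal O(1)$ (i.e. for $t$ in any bounded time interval fixed independently of $\varepsilon$).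
   Context: Setting: $n_x,n_y\ge1$ are integers, $0<\varepsilon\le\varepsilon_0\ll1$, and $f:\mathbb R^{n_x}\times\mathbb R^{n_y}\to\mathbb R^{n_x}$, $g:\mathbb R^{n_x}\times\mathbb R^{n_y}\to\mathbb R^{n_y}$ are sufficiently smooth functions such that, for some integer $K\ge1$, $f\in W^{K,\infty}$ and $\nabla g\in W^{K,\infty}$, where $\|\xi\|_{k,\infty}=\max_{0\le j\le k}\|\nabla^j\xi\|_{L^\infty}$ is the $W^{k,\infty}$ norm. For each $x\in\mathbb R^{n_x}$ there is $\gamma(x)\in\mathbb R^{n_y}$ with $g(x,\gamma(x))=0$, and there is $\beta>0$ with $\langle g(x,y)-g(x,\tilde y),y-\tilde y\rangle\le-\beta|y-\tilde y|^2$ for all $x\in\mathbb R^{n_x}$, $y,\tilde y\in\mathbb R^{n_y}$ (so $\gamma(x)$ is unique). Definitions: Put $F(x)=f(x,\gamma(x))$, $F_y(x)=\left[\frac{\partial f^i}{\partial y^j}(x,\gamma(x))\right]_{i,j}$, $G_y(x)=\left[\frac{\partial g^i}{\partial y^j}(x,\gamma(x))\right]_{i,j}$ (an invertible matrix), $G_{yy}^{i,j,k}(x)=\frac{\partial^2g^i}{\partial y^j\partial y^k}(x,\gamma(x))$, and $$\gamma_1(x)=G_y(x)^{-1}\nabla\gamma(x)F(x),$$ $$\gamma_2(x)=G_y(x)^{-1}\Big(\nabla\gamma(x)F_y(x)\gamma_1(x)+\nabla\gamma_1(x)F(x)-\tfrac12\Big[\sum_{j,k=1}^{n_y}G_{yy}^{i,j,k}(x)\gamma_1^j(x)\gamma_1^k(x)\Big]_{i=1}^{n_y}\Big).$$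 Here $\nabla\gamma$, $\nabla\gamma_1$ are Jacobian matrices ($n_y\times n_x$) and superscripts denote components.
   Formalization: The integer K is required to be at least 2 (f of class C^K, g of class C^{K+1}); for K = 1 the stated bounds do not control the gradient of γ_2 and the ε^3 estimate can fail. *)

theory Defs
  imports
    "HOL-Analysis.Analysis"
    "HOL-Probability.Essential_Supremum"
    "HOL-Library.Landau_Symbols"
begin

primrec C_k :: "nat \<Rightarrow> ('a::euclidean_space \<Rightarrow> 'b::euclidean_space) \<Rightarrow> bool" where
  "C_k 0 h \<longleftrightarrow> continuous_on UNIV h"
| "C_k (Suc k) h \<longleftrightarrow> (\<forall>p. h differentiable (at p)) \<and>
     (\<forall>v\<in>Basis. C_k k (\<lambda>p. frechet_derivative h (at p) v))"

(* The squared Frobenius norm of the tensor of all partial derivatives of order j at p. *)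
primrec nabla_sq :: "nat \<Rightarrow> ('a::euclidean_space \<Rightarrow> 'b::euclidean_space) \<Rightarrow> 'a \<Rightarrow> real" where
  "nabla_sq 0 h p = (norm (h p))\<^sup>2"
| "nabla_sq (Suc j) h p = (\<Sum>v\<in>Basis. nabla_sq j (\<lambda>q. frechet_derivative h (at q) v) p)"

definition nabla_Linf :: "nat \<Rightarrow> ('a::euclidean_space \<Rightarrow> 'b::euclidean_space) \<Rightarrow> ereal" where
  "nabla_Linf j h = esssup lborel (\<lambda>p. ereal (sqrt (nabla_sq j h p)))"

definition W_norm :: "nat \<Rightarrow> ('a::euclidean_space \<Rightarrow> 'b::euclidean_space) \<Rightarrow> ereal" where
  "W_norm k h = (MAX j\<in>{..k}. nabla_Linf j h)"

(* The norm of the gradient of h in W^{k,infinity}: the j-th derivative of the gradient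
   is the (j+1)-st derivative of h. The function h itself may be unbounded. *)
definition W_norm_nabla :: "nat \<Rightarrow> ('a::euclidean_space \<Rightarrow> 'b::euclidean_space) \<Rightarrow> ereal" where
  "W_norm_nabla k h = (MAX j\<in>{..k}. nabla_Linf (Suc j) h)"

definition partial :: "'m::finite \<Rightarrow> (real^'m \<Rightarrow> real) \<Rightarrow> real^'m \<Rightarrow> real" where
  "partial j h y = frechet_derivative h (at y) (axis j 1)"

definition slow_F :: "((real^'n::finite) \<times> (real^'m::finite) \<Rightarrow> real^'n) \<Rightarrow>
    (real^'n \<Rightarrow> real^'m) \<Rightarrow> real^'n \<Rightarrow> real^'n" where
  "slow_F f \<gamma> x = f (x, \<gamma> x)"

definition jac_y :: "((real^'n::finite) \<times> (real^'m::finite) \<Rightarrow> real^'k::finite) \<Rightarrow>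
    (real^'n \<Rightarrow> real^'m) \<Rightarrow> real^'n \<Rightarrow> real^'m^'k" where
  "jac_y h \<gamma> x = (\<chi> i j. partial j (\<lambda>y. h (x, y) $ i) (\<gamma> x))"

definition hess_y :: "((real^'n::finite) \<times> (real^'m::finite) \<Rightarrow> real^'k::finite) \<Rightarrow>
    (real^'n \<Rightarrow> real^'m) \<Rightarrow> real^'n \<Rightarrow> 'k \<Rightarrow> 'm \<Rightarrow> 'm \<Rightarrow> real" where
  "hess_y h \<gamma> x i j k = partial j (partial k (\<lambda>y. h (x, y) $ i)) (\<gamma> x)"

definition gamma1 :: "((real^'n::finite) \<times> (real^'m::finite) \<Rightarrow> real^'n) \<Rightarrow>
    ((real^'n) \<times> (real^'m) \<Rightarrow> real^'m) \<Rightarrow> (real^'n \<Rightarrow> real^'m) \<Rightarrow> real^'n \<Rightarrow> real^'m" where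
  "gamma1 f g \<gamma> x =
     matrix_inv (jac_y g \<gamma> x) *v (jacobian \<gamma> (at x) *v slow_F f \<gamma> x)"

definition gamma2 :: "((real^'n::finite) \<times> (real^'m::finite) \<Rightarrow> real^'n) \<Rightarrow>
    ((real^'n) \<times> (real^'m) \<Rightarrow> real^'m) \<Rightarrow> (real^'n \<Rightarrow> real^'m) \<Rightarrow> real^'n \<Rightarrow> real^'m" where
  "gamma2 f g \<gamma> x = matrix_inv (jac_y g \<gamma> x) *v
     (jacobian \<gamma> (at x) *v (jac_y f \<gamma> x *v gamma1 f g \<gamma> x)
      + jacobian (gamma1 f g \<gamma>) (at x) *v slow_F f \<gamma> x
      - (1/2) *\<^sub>R (\<chi> i. \<Sum>j\<in>UNIV. \<Sum>k\<in>UNIV.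
          hess_y g \<gamma> x i j k * gamma1 f g \<gamma> x $ j * gamma1 f g \<gamma> x $ k))"

definition Gamma2 :: "((real^'n::finite) \<times> (real^'m::finite) \<Rightarrow> real^'n) \<Rightarrow>
    ((real^'n) \<times> (real^'m) \<Rightarrow> real^'m) \<Rightarrow> (real^'n \<Rightarrow> real^'m) \<Rightarrow>
    real^'n \<Rightarrow> real \<Rightarrow> real^'m" where
  "Gamma2 f g \<gamma> x \<epsilon> = \<gamma> x + \<epsilon> *\<^sub>R gamma1 f g \<gamma> x + \<epsilon>\<^sup>2 *\<^sub>R gamma2 f g \<gamma> x"

definition solves_slow_fast :: "((real^'n::finite) \<times> (real^'m::finite) \<Rightarrow> real^'n) \<Rightarrow>
    ((real^'n) \<times> (real^'m) \<Rightarrow> real^'m) \<Rightarrow> real \<Rightarrow>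
    (real \<Rightarrow> real^'n) \<Rightarrow> (real \<Rightarrow> real^'m) \<Rightarrow> bool" where
  "solves_slow_fast f g \<epsilon> x y \<longleftrightarrow> (\<forall>t\<ge>0.
     (x has_vector_derivative f (x t, y t)) (at t within {0..}) \<and>
     (y has_vector_derivative (1 / \<epsilon>) *\<^sub>R g (x t, y t)) (at t within {0..}))"

definition solves_reduced :: "((real^'n::finite) \<times> (real^'m::finite) \<Rightarrow> real^'n) \<Rightarrow>
    ((real^'n) \<times> (real^'m) \<Rightarrow> real^'m) \<Rightarrow> (real^'n \<Rightarrow> real^'m) \<Rightarrow> real \<Rightarrow>
    (real \<Rightarrow> real^'n) \<Rightarrow> bool" where
  "solves_reduced f g \<gamma> \<epsilon> X \<longleftrightarrow> (\<forall>t\<ge>0.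
     (X has_vector_derivative f (X t, Gamma2 f g \<gamma> (X t) \<epsilon>)) (at t within {0..}))"

end

theory Submission
  imports Defs
begin

text \<open>Write \<open>\<Gamma>\<close> for \<open>Gamma2 f g \<gamma> \<cdot> \<epsilon>\<close>. The coefficients \<open>\<gamma>\<^sub>1\<close>, \<open>\<gamma>\<^sub>2\<close> make the residual
  \<open>g (x, \<Gamma> x) - \<epsilon> D\<Gamma>(x) f (x, \<Gamma> x)\<close> of order \<open>\<epsilon>\<^sup>3\<close>, uniformly in \<open>x\<close>. With \<open>w = x - X\<close> and
  \<open>z = y - \<Gamma> x\<close>, monotonicity of \<open>g\<close> then bounds the derivative of \<open>\<bar>z\<bar>\<^sup>2\<close> by
  \<open>- (2 \<beta> / \<epsilon>) \<bar>z\<bar>\<^sup>2\<close> plus small terms, so that the term \<open>\<bar>z\<bar>\<^sup>2\<close> produced by differentiating \<open>\<bar>w\<bar>\<^sup>2\<close> is absorbed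
  in \<open>\<Psi> = \<bar>w\<bar>\<^sup>2 + \<epsilon>\<^sup>6 + (\<epsilon> / \<beta>) \<bar>z\<bar>\<^sup>2\<close>, which satisfies \<open>\<Psi>' \<le> C \<Psi>\<close>. Uniform bounds on the
  derivatives of \<open>\<gamma>\<close>, \<open>\<gamma>\<^sub>1\<close>, \<open>\<gamma>\<^sub>2\<close> come from the fact that \<open>\<gamma>\<^sub>1\<close>, \<open>\<gamma>\<^sub>2\<close> and all these
  derivatives solve linear systems with the coercive matrix \<open>\<partial>g/\<partial>y\<close>.\<close>

subsection \<open>Bounded functions with bounded derivatives\<close>

text \<open>The correctors come from inserting \<open>\<Gamma>\<close> into the invariance equation
  g = \<epsilon> D\<Gamma> f and matching powers of \<epsilon>: the first order is the system for
  \<open>\<gamma>\<^sub>1\<close>, the second the system for \<open>\<gamma>\<^sub>2\<close>. The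
  obstacle is uniformity over the whole space. Since \<open>g\<close> and \<open>\<gamma>\<close>
  may be unbounded, bounds are placed on their derivatives only. Moreover \<open>\<gamma>\<close> is
  known solely through g = 0, so its Lipschitz bound, its differentiability and the bounds on its
  higher derivatives are extracted from monotonicity in turn. The available derivatives are spent as
  follows: the derivative of \<open>\<gamma>\<close> and \<open>\<gamma>\<^sub>1\<close> itself have
  two bounded derivatives, \<open>\<gamma>\<^sub>2\<close> has one, and the derivative of
  \<open>\<gamma>\<^sub>2\<close>, the last term of D\<Gamma>, is bounded. The weight
  \<epsilon>/\<beta> rescales the decay rate 2\<beta>/\<epsilon> to 2. Young's inequality trades the
  forcing of size \<epsilon>^3 against this decay and leaves its square \<epsilon>^6; carrying
  \<epsilon>^6 inside \<Psi> makes the final differential inequality homogeneous.\<close>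

text \<open>The point is the last argument, so that \<open>dirder v h\<close> is again a function
  and can be differentiated further.\<close>

definition dirder :: "'a::real_normed_vector \<Rightarrow> ('a \<Rightarrow> 'b::real_normed_vector) \<Rightarrow> 'a \<Rightarrow> 'b" where
  "dirder v h p = frechet_derivative h (at p) v"

lemma dirder_eq: "(h has_derivative h') (at p) \<Longrightarrow> dirder v h p = h' v"
  unfolding dirder_def by (simp add: frechet_derivative_at[symmetric])

lemma has_derivative_dirder:
  "h differentiable (at p) \<Longrightarrow> (h has_derivative (\<lambda>v. dirder v h p)) (at p)"
  unfolding dirder_def by (simp add: frechet_derivative_works)

lemma linear_dirder: "h differentiable (at p) \<Longrightarrow> linear (\<lambda>v. dirder v h p)"
  using has_derivative_dirder has_derivative_linear by blast

lemma dirder_sum_Basis: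
  fixes h :: "'a::euclidean_space \<Rightarrow> 'b::real_normed_vector"
  assumes "h differentiable (at p)"
  shows "dirder v h p = (\<Sum>b\<in>Basis. (v \<bullet> b) *\<^sub>R dirder b h p)"
proof -
  have "dirder v h p = dirder (\<Sum>b\<in>Basis. (v \<bullet> b) *\<^sub>R b) h p"
    by (simp add: euclidean_representation)
  also have "\<dots> = (\<Sum>b\<in>Basis. (v \<bullet> b) *\<^sub>R dirder b h p)"
    by (subst linear_sum[OF linear_dirder[OF assms]]) (simp add: linear_cmul[OF linear_dirder[OF assms]])
  finally show ?thesis .
qed

text \<open>A pointwise counterpart of the W^{k,infinity} classes, with suprema in place of
  essential suprema. Recursing through basis directions keeps the codomain fixed, so derivatives of
  every order have the same type.\<close>

primrec bounded_C :: "nat \<Rightarrow> ('a::euclidean_space \<Rightarrow> 'b::real_normed_vector) \<Rightarrow> bool" where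
  "bounded_C 0 h \<longleftrightarrow> continuous_on UNIV h \<and> bounded (range h)"
| "bounded_C (Suc k) h \<longleftrightarrow> bounded (range h) \<and> (\<forall>p. h differentiable (at p)) \<and>
     (\<forall>v\<in>Basis. bounded_C k (dirder v h))"

lemma bounded_C_bounded: "bounded_C k h \<Longrightarrow> bounded (range h)"
  by (cases k) auto

lemma bounded_C_continuous: "bounded_C k h \<Longrightarrow> continuous_on UNIV h"
  by (cases k) (auto intro!: differentiable_imp_continuous_on simp: differentiable_on_def)

lemma bounded_C_differentiable: "bounded_C k h \<Longrightarrow> 0 < k \<Longrightarrow> h differentiable (at p)"
  by (cases k) auto

lemma bounded_C_0: "bounded_C k h \<Longrightarrow> bounded_C 0 h"
  using bounded_C_bounded bounded_C_continuous by auto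

lemma bounded_C_mono: "bounded_C k h \<Longrightarrow> j \<le> k \<Longrightarrow> bounded_C j h"
proof (induction k arbitrary: h j)
  case (Suc k)
  show ?case
  proof (cases j)
    case 0
    then show ?thesis using bounded_C_0[OF Suc.prems(1)] by blast
  next
    case (Suc i)
    then show ?thesis using Suc.prems Suc.IH by simp
  qed
qed simp

lemma bounded_C_const: "bounded_C k (\<lambda>_::'a::euclidean_space. c)"
proof (induction k arbitrary: c)
  case (Suc k)
  have "dirder v (\<lambda>_. c) = (\<lambda>_. 0)" for v :: 'a
    by (rule ext, rule dirder_eq) simp
  then show ?case using Suc by simp
qed simp

lemma bounded_C_add: "bounded_C k h \<Longrightarrow> bounded_C k k' \<Longrightarrow> bounded_C k (\<lambda>p. h p + k' p)"
proof (induction k arbitrary: h k')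
  case 0
  then show ?case by (auto intro: continuous_on_add bounded_plus_comp)
next
  case (Suc k)
  have "dirder v (\<lambda>p. h p + k' p) = (\<lambda>p. dirder v h p + dirder v k' p)" for v
    using Suc.prems by (intro ext dirder_eq has_derivative_add has_derivative_dirder) auto
  then show ?case using Suc by (auto intro: bounded_plus_comp)
qed

lemma bounded_C_linear:
  assumes L: "bounded_linear L"
  shows "bounded_C k h \<Longrightarrow> bounded_C k (\<lambda>p. L (h p))"
proof (induction k arbitrary: h)
  case 0
  have "bounded (range (\<lambda>p. L (h p)))"
    using bounded_linear_image[OF bounded_C_bounded[OF 0] L] by (simp add: image_image)
  then show ?case
    using bounded_linear.continuous_on[OF L bounded_C_continuous[OF 0]] by simp
next
  case (Suc k)
  have D: "((\<lambda>p. L (h p)) has_derivative (\<lambda>v. L (dirder v h p))) (at p)" for p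
    using Suc.prems by (intro bounded_linear.has_derivative[OF L] has_derivative_dirder) auto
  then have E: "dirder v (\<lambda>p. L (h p)) = (\<lambda>p. L (dirder v h p))" for v
    by (intro ext dirder_eq)
  have "bounded (range (\<lambda>p. L (h p)))"
    using bounded_linear_image[OF bounded_C_bounded[OF Suc.prems] L] by (simp add: image_image)
  then show ?case using Suc.IH Suc.prems E differentiableI[OF D] by simp
qed

lemma bounded_range_scaleR:
  fixes s :: "'a \<Rightarrow> real" and h :: "'a \<Rightarrow> 'b::real_normed_vector"
  assumes "bounded (range s)" "bounded (range h)"
  shows "bounded (range (\<lambda>p. s p *\<^sub>R h p))"
proof -
  obtain A B where "\<And>p. norm (s p) \<le> A" "\<And>p. norm (h p) \<le> B"
    using assms by (auto simp: bounded_iff)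
  then have "norm (s p *\<^sub>R h p) \<le> A * B" for p
    unfolding norm_scaleR real_norm_def[symmetric]
    by (meson mult_mono norm_ge_zero order_trans)
  then show ?thesis by (auto simp: bounded_iff)
qed

lemma bounded_C_scaleR:
  "bounded_C k s \<Longrightarrow> bounded_C k h \<Longrightarrow> bounded_C k (\<lambda>p. s p *\<^sub>R h p)"
proof (induction k arbitrary: s h)
  case 0
  then show ?case by (auto intro: continuous_on_scaleR bounded_range_scaleR)
next
  case (Suc k)
  have D: "((\<lambda>p. s p *\<^sub>R h p) has_derivative (\<lambda>v. s p *\<^sub>R dirder v h p + dirder v s p *\<^sub>R h p)) (at p)" for p
    using Suc.prems by (intro has_derivative_scaleR has_derivative_dirder) auto
  then have "dirder v (\<lambda>p. s p *\<^sub>R h p) = (\<lambda>p. s p *\<^sub>R dirder v h p + dirder v s p *\<^sub>R h p)" for v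
    by (intro ext dirder_eq)
  moreover have "bounded_C k s" "bounded_C k h"
    using Suc.prems bounded_C_mono[of "Suc k" _ k] by auto
  ultimately show ?case using Suc differentiableI[OF D]
    by (auto intro: bounded_range_scaleR bounded_C_add)
qed

lemma bounded_C_sum:
  "finite I \<Longrightarrow> (\<And>i. i \<in> I \<Longrightarrow> bounded_C k (h i)) \<Longrightarrow> bounded_C k (\<lambda>p. \<Sum>i\<in>I. h i p)"
  by (induction I rule: finite_induct) (auto intro: bounded_C_const bounded_C_add)

lemma bounded_C_diff: "bounded_C k h \<Longrightarrow> bounded_C k h' \<Longrightarrow> bounded_C k (\<lambda>p. h p - h' p)"
  using bounded_C_add[OF _ bounded_C_linear[OF bounded_linear_minus[OF bounded_linear_ident]]]
  by fastforce

lemma bounded_C_component: "bounded_C k h \<Longrightarrow> bounded_C k (\<lambda>p. h p \<bullet> b)"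
  by (rule bounded_C_linear[OF bounded_linear_inner_left])

text \<open>The chain rule involves \<open>\<sigma>\<close> only through its derivatives, so
  \<open>\<sigma>\<close> itself may be unbounded, as the graph map of \<open>\<gamma>\<close> is.
  One derivative is spent on the chain rule, hence the classes j < k for
  \<open>dirder v \<sigma>\<close>; the strict inequality permits bootstrapping.\<close>

lemma bounded_C_compose:
  fixes h :: "'b::euclidean_space \<Rightarrow> 'c::real_normed_vector" and \<sigma> :: "'a::euclidean_space \<Rightarrow> 'b"
  assumes \<sigma>: "\<And>p. \<sigma> differentiable (at p)"
  shows "bounded_C k h \<Longrightarrow> (\<And>j v. j < k \<Longrightarrow> v \<in> Basis \<Longrightarrow> bounded_C j (dirder v \<sigma>)) \<Longrightarrow>
    bounded_C k (\<lambda>p. h (\<sigma> p))"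
proof (induction k arbitrary: h)
  case 0
  have "continuous_on UNIV \<sigma>"
    using \<sigma> by (auto intro!: differentiable_imp_continuous_on simp: differentiable_on_def)
  then show ?case using 0
    by (auto intro: continuous_on_compose2 bounded_subset)
next
  case (Suc k)
  have h: "h differentiable (at p)" for p using Suc.prems by simp
  have D: "((\<lambda>p. h (\<sigma> p)) has_derivative (\<lambda>v. dirder (dirder v \<sigma> p) h (\<sigma> p))) (at p)" for p
    using has_derivative_compose[OF has_derivative_dirder[OF \<sigma>] has_derivative_dirder[OF h]] .
  have E: "dirder v (\<lambda>p. h (\<sigma> p)) = (\<lambda>p. \<Sum>b\<in>Basis. (dirder v \<sigma> p \<bullet> b) *\<^sub>R dirder b h (\<sigma> p))" for v
    by (intro ext dirder_eq[OF D, THEN trans] dirder_sum_Basis h)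
  have "bounded_C k (dirder v (\<lambda>p. h (\<sigma> p)))" if "v \<in> Basis" for v
    unfolding E
    using Suc.prems that
    by (intro bounded_C_sum bounded_C_scaleR bounded_C_component Suc.IH) auto
  moreover have "bounded (range (\<lambda>p. h (\<sigma> p)))"
    using bounded_C_bounded[OF Suc.prems(1)] by (rule bounded_subset) auto
  ultimately show ?case using differentiableI[OF D] by simp
qed

lemma bounded_C_linear_combination:
  fixes u :: "'a::euclidean_space \<Rightarrow> 'b::euclidean_space"
  shows "bounded_C k u \<Longrightarrow> (\<And>b. b \<in> Basis \<Longrightarrow> bounded_C k (c b)) \<Longrightarrow>
    bounded_C k (\<lambda>p. \<Sum>b\<in>Basis. (u p \<bullet> b) *\<^sub>R c b p)"
  by (intro bounded_C_sum bounded_C_scaleR bounded_C_component) auto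

text \<open>Only the derivatives are bounded here, which makes the lemma applicable to
  \<open>g\<close> as well as to \<open>f\<close>.\<close>

lemma bounded_C_dirder_Lipschitz:
  fixes h :: "'a::euclidean_space \<Rightarrow> 'b::real_normed_vector"
  assumes h: "\<And>p. h differentiable (at p)"
    and bd: "\<And>b. b \<in> Basis \<Longrightarrow> bounded (range (dirder b h))"
  obtains L where "L > 0" "\<And>p v. norm (dirder v h p) \<le> L * norm v"
    "\<And>p q. norm (h p - h q) \<le> L * norm (p - q)"
proof -
  have "\<exists>B. \<forall>p. norm (dirder b h p) \<le> B" if "b \<in> Basis" for b
    using bd[OF that] by (auto simp: bounded_iff)
  then obtain B where B: "\<And>b p. b \<in> Basis \<Longrightarrow> norm (dirder b h p) \<le> B b"
    by metis
  \<comment> \<open>The summand 1 makes \<open>L\<close> positive even when all derivatives vanish;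
    later constants divide by it.\<close>
  define L where "L = (\<Sum>b\<in>(Basis::'a set). \<bar>B b\<bar>) + 1"
  have 1: "L > 0" unfolding L_def by (intro add_nonneg_pos sum_nonneg) auto
  have 2: "norm (dirder v h p) \<le> L * norm v" for p v
  proof -
    have "norm (dirder v h p) \<le> (\<Sum>b\<in>Basis. norm ((v \<bullet> b) *\<^sub>R dirder b h p))"
      by (subst dirder_sum_Basis[OF h]) (rule norm_sum)
    also have "\<dots> \<le> (\<Sum>b\<in>Basis. norm v * \<bar>B b\<bar>)"
    proof (rule sum_mono)
      fix b :: 'a assume b: "b \<in> Basis"
      have "norm (dirder b h p) \<le> \<bar>B b\<bar>" using B[OF b, of p] by linarith
      then show "norm ((v \<bullet> b) *\<^sub>R dirder b h p) \<le> norm v * \<bar>B b\<bar>"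
        unfolding norm_scaleR using Basis_le_norm[OF b, of v] by (intro mult_mono) auto
    qed
    also have "\<dots> \<le> L * norm v"
      by (simp add: L_def algebra_simps sum_distrib_left)
    finally show ?thesis .
  qed
  have "norm (h p - h q) \<le> L * norm (p - q)" for p q
  proof (rule differentiable_bound[of UNIV h "\<lambda>p v. dirder v h p"])
    show "onorm (\<lambda>v. dirder v h p) \<le> L" for p
      by (rule onorm_le) (rule 2)
  qed (simp_all add: has_derivative_dirder[OF h])
  with 1 2 show ?thesis by (rule that)
qed

lemma bounded_C_norm_le:
  assumes "bounded_C k h"
  obtains B where "B \<ge> 0" "\<And>p. norm (h p) \<le> B"
proof -
  obtain B where "\<And>p. norm (h p) \<le> B"
    using bounded_C_bounded[OF assms] by (auto simp: bounded_iff)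
  then show ?thesis using norm_ge_zero order_trans that by metis
qed

text \<open>Covers derivatives whose base point and direction both move with x. Linearity in the
  direction reduces them to fixed basis directions with varying coefficients.\<close>

lemma bounded_C_dirder_at:
  fixes h :: "'a::euclidean_space \<Rightarrow> 'b::euclidean_space" and \<sigma> :: "'c::euclidean_space \<Rightarrow> 'a"
  assumes "\<And>p. h differentiable (at p)"
    and "\<And>b. b \<in> Basis \<Longrightarrow> bounded_C k (\<lambda>x. dirder b h (\<sigma> x))" and "bounded_C k w"
  shows "bounded_C k (\<lambda>x. dirder (w x) h (\<sigma> x))"
  using bounded_C_linear_combination[of k w "\<lambda>b x. dirder b h (\<sigma> x)"] assms(2,3)
  unfolding dirder_sum_Basis[OF assms(1), symmetric] by simp

lemma bounded_C_dirder:
  fixes h :: "'a::euclidean_space \<Rightarrow> 'b::euclidean_space"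
  assumes "\<And>p. h differentiable (at p)" and "\<And>b. b \<in> Basis \<Longrightarrow> bounded_C k (dirder b h)"
  shows "bounded_C k (dirder v h)"
  using bounded_C_dirder_at[OF assms(1), of k "\<lambda>x. x" "\<lambda>_. v"] assms(2)
  by (simp add: bounded_C_const)

lemma bounded_C_dirder_Suc:
  fixes h :: "'a::euclidean_space \<Rightarrow> 'b::euclidean_space"
  assumes "bounded_C (Suc k) h"
  shows "bounded_C k (dirder v h)"
  by (rule bounded_C_dirder[OF bounded_C_differentiable[OF assms]]) (use assms in auto)

text \<open>This is linearity in the inner direction: with u fixed the coefficients are constants,
  so the outer derivative passes through the sum.\<close>

lemma dirder_dirder_sum_Basis:
  fixes h :: "'a::euclidean_space \<Rightarrow> 'b::euclidean_space"
  assumes d: "\<And>p. h differentiable (at p)"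
    and d2: "\<And>b p. b \<in> Basis \<Longrightarrow> dirder b h differentiable (at p)"
  shows "dirder v (dirder u h) p = (\<Sum>b\<in>Basis. (u \<bullet> b) *\<^sub>R dirder v (dirder b h) p)"
proof (rule dirder_eq)
  have "((\<lambda>q. \<Sum>b\<in>Basis. (u \<bullet> b) *\<^sub>R dirder b h q) has_derivative
      (\<lambda>v. \<Sum>b\<in>Basis. (u \<bullet> b) *\<^sub>R dirder v (dirder b h) p)) (at p)"
    by (intro has_derivative_sum has_derivative_scaleR_right has_derivative_dirder d2)
  then show "(dirder u h has_derivative
      (\<lambda>v. \<Sum>b\<in>Basis. (u \<bullet> b) *\<^sub>R dirder v (dirder b h) p)) (at p)"
    unfolding dirder_sum_Basis[OF d, of u, symmetric] .
qed

lemma norm_linear_combination_le: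
  fixes u :: "'a::euclidean_space" and c :: "'a \<Rightarrow> 'b::real_normed_vector"
  assumes "\<And>b. b \<in> Basis \<Longrightarrow> norm (c b) \<le> B b"
  shows "norm (\<Sum>b\<in>Basis. (u \<bullet> b) *\<^sub>R c b) \<le> norm u * (\<Sum>b\<in>Basis. B b)"
proof -
  have "norm (\<Sum>b\<in>Basis. (u \<bullet> b) *\<^sub>R c b) \<le> (\<Sum>b\<in>Basis. norm ((u \<bullet> b) *\<^sub>R c b))"
    by (rule norm_sum)
  also have "\<dots> \<le> (\<Sum>b\<in>Basis. norm u * B b)"
  proof (rule sum_mono)
    fix b :: 'a assume b: "b \<in> Basis"
    show "norm ((u \<bullet> b) *\<^sub>R c b) \<le> norm u * B b"
      unfolding norm_scaleR
      by (rule mult_mono[OF Basis_le_norm[OF b] assms[OF b]]) auto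
  qed
  finally show ?thesis by (simp add: sum_distrib_left)
qed

lemma dirder2_bound:
  fixes h :: "'a::euclidean_space \<Rightarrow> 'b::euclidean_space"
  assumes d: "\<And>p. h differentiable (at p)" and b: "\<And>b. b \<in> Basis \<Longrightarrow> bounded_C 1 (dirder b h)"
  obtains B where "B \<ge> 0" "\<And>u v p. norm (dirder u (dirder v h) p) \<le> norm u * norm v * B"
proof -
  have "\<exists>L\<ge>0. \<forall>u p. norm (dirder u (dirder b h) p) \<le> L * norm u" if "b \<in> Basis" for b
  proof -
    have "bounded_C (Suc 0) (dirder b h)" using b[OF that] by simp
    then have 1: "dirder b h differentiable (at p)" and 2: "v \<in> Basis \<Longrightarrow> bounded (range (dirder v (dirder b h)))" for v p
      by auto
    obtain L where "L > 0" "\<And>p v. norm (dirder v (dirder b h) p) \<le> L * norm v"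
      by (rule bounded_C_dirder_Lipschitz[OF 1 2]) (assumption, rule that)
    then show ?thesis by (intro exI[of _ L]) auto
  qed
  then obtain L where L: "\<And>b. b \<in> Basis \<Longrightarrow> L b \<ge> 0"
      "\<And>b u p. b \<in> Basis \<Longrightarrow> norm (dirder u (dirder b h) p) \<le> L b * norm u" by metis
  have "norm (dirder u (dirder v h) p) \<le> norm u * norm v * (\<Sum>b\<in>Basis. L b)" for u v p
  proof -
    have "dirder u (dirder v h) p = (\<Sum>b\<in>Basis. (v \<bullet> b) *\<^sub>R dirder u (dirder b h) p)"
      using b by (intro dirder_dirder_sum_Basis d) auto
    also have "norm \<dots> \<le> norm v * (\<Sum>b\<in>Basis. L b * norm u)"
      using L(2) by (intro norm_linear_combination_le) auto
    finally show ?thesis by (simp add: sum_distrib_right[symmetric] mult_ac)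
  qed
  moreover have "(\<Sum>b\<in>Basis. L b) \<ge> 0" using L(1) by (rule sum_nonneg)
  ultimately show ?thesis by (rule that[rotated])
qed

text \<open>The second-order bound applies to each \<open>dirder b h\<close>; expanding the
  innermost direction w in the basis then gives a bound that is uniform in all three
  directions.\<close>

lemma dirder3_bound:
  fixes h :: "'a::euclidean_space \<Rightarrow> 'b::euclidean_space"
  assumes d: "\<And>p. h differentiable (at p)" and b: "\<And>b. b \<in> Basis \<Longrightarrow> bounded_C 2 (dirder b h)"
  obtains B where "B \<ge> 0"
    "\<And>u v w p. norm (dirder u (dirder v (dirder w h)) p) \<le> norm u * norm v * norm w * B"
proof -
  have b': "bounded_C (Suc 1) (dirder b h)" if "b \<in> Basis" for b
    using b[OF that] by (simp add: numeral_2_eq_2)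
  have d': "dirder b h differentiable (at p)" if "b \<in> Basis" for b p
    by (rule bounded_C_differentiable[OF b'[OF that]]) simp
  have "\<exists>L\<ge>0. \<forall>u v p. norm (dirder u (dirder v (dirder b h)) p) \<le> norm u * norm v * L"
    if "b \<in> Basis" for b
  proof -
    have "bounded_C 1 (dirder v (dirder b h))" if "v \<in> Basis" for v
      using b'[OF \<open>b \<in> Basis\<close>] that by simp
    note bound = dirder2_bound[OF d'[OF that] this]
    obtain L where "L \<ge> 0" "\<And>u v p. norm (dirder u (dirder v (dirder b h)) p) \<le> norm u * norm v * L"
      by (rule bound) (assumption, rule that)
    then show ?thesis by blast
  qed
  then obtain L where L: "\<And>b. b \<in> Basis \<Longrightarrow> L b \<ge> 0"
      "\<And>b u v p. b \<in> Basis \<Longrightarrow> norm (dirder u (dirder v (dirder b h)) p) \<le> norm u * norm v * L b"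
    by metis
  have dd: "dirder v (dirder b h) differentiable (at p)" if "b \<in> Basis" for b v p
  proof -
    have "bounded_C 1 (dirder v (dirder b h))"
      by (rule bounded_C_dirder[OF d'[OF that]]) (use b'[OF that] in simp)
    then show ?thesis by simp
  qed
  have "norm (dirder u (dirder v (dirder w h)) p) \<le> norm u * norm v * norm w * (\<Sum>b\<in>Basis. L b)" for u v w p
  proof -
    have "dirder v (dirder w h) = (\<lambda>q. \<Sum>b\<in>Basis. (w \<bullet> b) *\<^sub>R dirder v (dirder b h) q)"
      by (intro ext dirder_dirder_sum_Basis d d')
    then have "dirder u (dirder v (dirder w h)) p = (\<Sum>b\<in>Basis. (w \<bullet> b) *\<^sub>R dirder u (dirder v (dirder b h)) p)"
      by (simp, intro dirder_eq has_derivative_sum has_derivative_scaleR_right has_derivative_dirder dd)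
    also have "norm \<dots> \<le> norm w * (\<Sum>b\<in>Basis. norm u * norm v * L b)"
      using L(2) by (intro norm_linear_combination_le) auto
    finally show ?thesis by (simp add: sum_distrib_right[symmetric] mult_ac)
  qed
  moreover have "(\<Sum>b\<in>Basis. L b) \<ge> 0" using L(1) by (rule sum_nonneg)
  ultimately show ?thesis by (rule that[rotated])
qed

section \<open>From essential-supremum norms to pointwise bounds on derivatives\<close>

lemma C_k_continuous: "C_k k h \<Longrightarrow> continuous_on UNIV h"
  by (cases k) (auto intro!: differentiable_imp_continuous_on simp: differentiable_on_def)

lemma C_k_Suc_dirder:
  "C_k (Suc k) h \<longleftrightarrow> (\<forall>p. h differentiable (at p)) \<and> (\<forall>v\<in>Basis. C_k k (dirder v h))"
  by (simp add: dirder_def[abs_def])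

lemma nabla_sq_Suc_dirder: "nabla_sq (Suc j) h p = (\<Sum>v\<in>Basis. nabla_sq j (dirder v h) p)"
  by (simp add: dirder_def[abs_def])

lemma nabla_sq_nonneg: "nabla_sq j h p \<ge> 0"
  by (induction j arbitrary: h) (auto intro: sum_nonneg)

lemma continuous_on_nabla_sq:
  "C_k k h \<Longrightarrow> j \<le> k \<Longrightarrow> continuous_on UNIV (nabla_sq j h)"
proof (induction j arbitrary: k h)
  case 0
  then show ?case using C_k_continuous[OF 0(1)] by (auto intro: continuous_intros)
next
  case (Suc j)
  then obtain i where i: "k = Suc i" "j \<le> i" by (cases k) auto
  have "continuous_on UNIV (\<lambda>p. \<Sum>v\<in>Basis. nabla_sq j (dirder v h) p)"
    using Suc.prems(1) unfolding i C_k_Suc_dirder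
    by (intro continuous_on_sum) (use Suc.IH[OF _ i(2)] in auto)
  then show ?case by (simp add: nabla_sq_Suc_dirder[abs_def] del: nabla_sq.simps)
qed

text \<open>For a continuous function the set where an essential bound fails is open and null, hence
  empty.\<close>

lemma continuous_le_esssup:
  fixes \<phi> :: "'a::euclidean_space \<Rightarrow> real"
  assumes c: "continuous_on UNIV \<phi>" and fin: "esssup lborel (\<lambda>p. ereal (\<phi> p)) < \<infinity>"
  obtains B where "\<And>p. \<phi> p \<le> B"
proof -
  obtain B where B: "esssup lborel (\<lambda>p. ereal (\<phi> p)) \<le> ereal B"
    using fin by (metis ereal_dense2 less_imp_le)
  have "AE p in lborel. ereal (\<phi> p) \<le> ereal B"
    using esssup_AE by (rule eventually_mono) (rule order_trans[OF _ B])
  then have "AE p in lborel. \<phi> p \<le> B" by simp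
  then have "AE p in lebesgue. \<phi> p \<le> B" by (rule AE_completion)
  then have ae: "AE p in lebesgue. p \<notin> {p. B < \<phi> p}"
    by (rule eventually_mono) simp
  have op: "open {p. B < \<phi> p}"
    by (intro open_Collect_less continuous_on_const c)
  have "{p. B < \<phi> p} \<in> sets lebesgue"
    by (rule sets_completionI_sets) (simp add: borel_open[OF op])
  then have "negligible {p. B < \<phi> p}"
    unfolding negligible_iff_null_sets using ae AE_iff_null_sets by blast
  then have "{p. B < \<phi> p} = {}" using open_not_negligible[OF op] by blast
  then have "\<phi> p \<le> B" for p by (simp add: set_eq_iff not_less)
  then show ?thesis by (rule that)
qed

lemma nabla_Linf_bound:
  assumes "C_k k h" "j \<le> k" "nabla_Linf j h < \<infinity>"
  obtains B where "\<And>p. nabla_sq j h p \<le> B"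
proof -
  have "continuous_on UNIV (\<lambda>p. sqrt (nabla_sq j h p))"
    by (intro continuous_intros continuous_on_nabla_sq[OF assms(1,2)])
  then obtain B where B: "\<And>p. sqrt (nabla_sq j h p) \<le> B"
    using continuous_le_esssup assms(3) unfolding nabla_Linf_def by blast
  have "nabla_sq j h p \<le> B\<^sup>2" for p
    using B[of p] nabla_sq_nonneg[of j h p] by (metis real_sqrt_le_iff real_sqrt_pow2 power_mono real_sqrt_ge_zero)
  then show ?thesis by (rule that)
qed

text \<open>Order j of a directional derivative is one nonnegative summand of order j + 1 of h, so
  bounds descend to \<open>dirder v h\<close> with the index shifted by one.\<close>

lemma bounded_C_nabla_sq:
  "C_k k h \<Longrightarrow> (\<And>j. j \<le> k \<Longrightarrow> \<exists>B. \<forall>p. nabla_sq j h p \<le> B) \<Longrightarrow> bounded_C k h"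
proof (induction k arbitrary: h)
  case 0
  then obtain B where B: "\<And>p. (norm (h p))\<^sup>2 \<le> B" by force
  have "norm (h p) \<le> sqrt B" for p using B[of p] by (rule real_le_rsqrt)
  then show ?case using 0 by (auto simp: bounded_iff)
next
  case (Suc k)
  obtain B where B: "\<And>p. (norm (h p))\<^sup>2 \<le> B" using Suc.prems(2)[of 0] by force
  have "norm (h p) \<le> sqrt B" for p using B[of p] by (rule real_le_rsqrt)
  then have "bounded (range h)" by (auto simp: bounded_iff)
  moreover have "bounded_C k (dirder v h)" if v: "v \<in> Basis" for v
  proof (rule Suc.IH)
    show "C_k k (dirder v h)" using Suc.prems(1) v unfolding C_k_Suc_dirder by blast
    fix j assume "j \<le> k"
    then obtain B where B: "\<And>p. nabla_sq (Suc j) h p \<le> B" using Suc.prems(2)[of "Suc j"] by force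
    have "nabla_sq j (dirder v h) p \<le> nabla_sq (Suc j) h p" for p
      unfolding nabla_sq_Suc_dirder
      by (rule member_le_sum[OF v]) (auto simp: nabla_sq_nonneg)
    then show "\<exists>B. \<forall>p. nabla_sq j (dirder v h) p \<le> B" using B by (meson order_trans)
  qed
  ultimately show ?case using Suc.prems(1) by simp
qed

lemma W_norm_bounded_C:
  assumes "C_k k h" "W_norm k h < \<infinity>"
  shows "bounded_C k h"
proof (rule bounded_C_nabla_sq[OF assms(1)])
  fix j assume j: "j \<le> k"
  have "nabla_Linf j h < \<infinity>"
    using assms(2) j unfolding W_norm_def by (subst (asm) Max_less_iff) auto
  then show "\<exists>B. \<forall>p. nabla_sq j h p \<le> B"
    using nabla_Linf_bound[OF assms(1) j] by blast
qed

text \<open>The gradient norm starts at order one and says nothing about the size of h, so the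
  conclusion concerns its derivatives only.\<close>

lemma W_norm_nabla_bounded_C:
  assumes C: "C_k (Suc k) h" "W_norm_nabla k h < \<infinity>" and v: "v \<in> Basis"
  shows "bounded_C k (dirder v h)"
proof (rule bounded_C_nabla_sq)
  show "C_k k (dirder v h)" using C(1) v unfolding C_k_Suc_dirder by blast
  fix j assume j: "j \<le> k"
  have "nabla_Linf (Suc j) h < \<infinity>"
    using C(2) j unfolding W_norm_nabla_def by (subst (asm) Max_less_iff) auto
  then obtain B where B: "\<And>p. nabla_sq (Suc j) h p \<le> B"
    using nabla_Linf_bound[OF C(1) Suc_le_mono[THEN iffD2, OF j]] by blast
  have "nabla_sq j (dirder v h) p \<le> nabla_sq (Suc j) h p" for p
    unfolding nabla_sq_Suc_dirder
    by (rule member_le_sum[OF v]) (auto simp: nabla_sq_nonneg)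
  then show "\<exists>B. \<forall>p. nabla_sq j (dirder v h) p \<le> B" using B by (meson order_trans)
qed

subsection \<open>Coercive linear systems\<close>

text \<open>Continuity of s is enough because d vanishes at x: replacing s(y) by s(x) changes the
  product by o(1) times O(|y - x|).\<close>

lemma has_derivative_scaleR_vanishing:
  fixes d :: "'a::real_normed_vector \<Rightarrow> 'b::real_normed_vector"
  assumes s: "continuous (at x) s" and d: "(d has_derivative d') (at x)" and "d x = 0"
  shows "((\<lambda>y. s y *\<^sub>R d y) has_derivative (\<lambda>v. s x *\<^sub>R d' v)) (at x)"
proof -
  \<comment> \<open>Differentiability and d(x) = 0 give linear growth of d near x; the constant is a
    bound for \<open>d'\<close> plus 1 for the remainder.\<close>
  obtain e K where K: "K > 0" "e > 0" "\<And>y. norm (y - x) < e \<Longrightarrow> norm (d y) \<le> K * norm (y - x)"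
  proof -
    have bl: "bounded_linear d'" using d by (rule has_derivative_bounded_linear)
    obtain K where K: "K > 0" "\<And>v. norm (d' v) \<le> norm v * K" using bounded_linear.pos_bounded[OF bl] by blast
    obtain e where e: "e > 0" "\<And>y. norm (y - x) < e \<Longrightarrow> norm (d y - d x - d' (y - x)) \<le> 1 * norm (y - x)"
      using d unfolding has_derivative_at_alt by (meson zero_less_one)
    have "norm (d y) \<le> (K + 1) * norm (y - x)" if "norm (y - x) < e" for y
    proof -
      have "norm (d y) \<le> norm (d y - d' (y - x)) + norm (d' (y - x))" by norm
      then show ?thesis using e(2)[OF that] K(2)[of "y - x"] assms(3) by (simp add: algebra_simps)
    qed
    then show ?thesis using that[of "K + 1" e] e(1) K(1) by simp
  qed
  have "((\<lambda>y. (s y - s x) *\<^sub>R d y) has_derivative (\<lambda>v. 0)) (at x)"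
    unfolding has_derivative_at_alt
  proof (intro conjI allI impI)
    fix r :: real assume r: "r > 0"
    then have "r / K > 0" using K by simp
    then obtain e' where e': "e' > 0" "\<And>y. dist y x < e' \<Longrightarrow> dist (s y) (s x) < r / K"
      using s unfolding continuous_at_eps_delta by metis
    show "\<exists>da>0. \<forall>y. norm (y - x) < da \<longrightarrow>
      norm ((s y - s x) *\<^sub>R d y - (s x - s x) *\<^sub>R d x - 0) \<le> r * norm (y - x)"
    proof (intro exI[of _ "min e e'"] conjI allI impI)
      fix y assume y: "norm (y - x) < min e e'"
      have "\<bar>s y - s x\<bar> * norm (d y) \<le> (r / K) * (K * norm (y - x))"
        using e'(2)[of y] K(3)[of y] y K r by (intro mult_mono) (auto simp: dist_norm)
      then show "norm ((s y - s x) *\<^sub>R d y - (s x - s x) *\<^sub>R d x - 0) \<le> r * norm (y - x)"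
        using K by simp
    qed (use K e' in auto)
  qed simp
  from has_derivative_add[OF this has_derivative_scaleR_right[OF d, of "s x"]]
  show ?thesis by (simp add: algebra_simps)
qed

lemma linear_inverse_of_coercive:
  fixes M :: "'b::euclidean_space \<Rightarrow> 'b"
  assumes lin: "linear M" and "\<beta> > 0" and "\<And>w. M w \<bullet> w \<le> - \<beta> * (norm w)\<^sup>2"
  obtains N where "bounded_linear N" "\<And>w. N (M w) = w" "\<And>w. M (N w) = w"
proof -
  have "M w = 0 \<Longrightarrow> w = 0" for w using assms(2) assms(3)[of w]
    by (auto simp: mult_le_0_iff zero_le_mult_iff)
  then have inj: "inj M" using lin by (simp add: linear_injective_0)
  then obtain N where "linear N" "\<And>w. M (N w) = w" "\<And>w. N (M w) = w"
    using linear_injective_isomorphism[OF lin inj] by blast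
  then show ?thesis using that linear_conv_bounded_linear by blast
qed

text \<open>Cauchy-Schwarz followed by division by |u|. It serves the linear systems and also the
  nonlinear monotonicity, with r a difference of values of \<open>g\<close>.\<close>

lemma coercive_norm_le:
  fixes u :: "'b::real_inner"
  assumes "\<beta> > 0" "r \<bullet> u \<le> - \<beta> * (norm u)\<^sup>2"
  shows "\<beta> * norm u \<le> norm r"
proof (cases "u = 0")
  case False
  have "- (r \<bullet> u) \<le> norm r * norm u"
    using Cauchy_Schwarz_ineq2[of r u] by linarith
  then have "(\<beta> * norm u) * norm u \<le> norm r * norm u"
    using assms by (simp add: power2_eq_square)
  then show ?thesis using False by simp
qed simp

text \<open>The derivative of the solution \<open>u\<close> of a linear system solves a system with the same
  matrix, which gives regularity of \<open>u\<close> without differentiating an inverse matrix.\<close>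

lemma bounded_C_solve:
  fixes c :: "'b \<Rightarrow> 'a::euclidean_space \<Rightarrow> 'b::euclidean_space"
  assumes \<beta>: "\<beta> > 0"
    and coercive: "\<And>x w. (\<Sum>b\<in>Basis. (w \<bullet> b) *\<^sub>R c b x) \<bullet> w \<le> - \<beta> * (norm w)\<^sup>2"
  shows "(\<And>b. b \<in> Basis \<Longrightarrow> bounded_C k (c b)) \<Longrightarrow> bounded_C k r \<Longrightarrow>
    (\<And>x. (\<Sum>b\<in>Basis. (u x \<bullet> b) *\<^sub>R c b x) = r x) \<Longrightarrow> bounded_C k u"
proof (induction k arbitrary: r u)
  case 0
  have "bounded (range r)" using 0 by simp
  then obtain R where R: "\<And>x. norm (r x) \<le> R" by (auto simp: bounded_iff)
  have "norm (u x) \<le> R / \<beta>" for x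
    using coercive_norm_le[OF \<beta> coercive[where w="u x" and x=x]] 0(3)[of x] R[of x] \<beta>
    by (simp add: field_simps)
  then have "bounded (range u)" by (auto simp: bounded_iff)
  moreover have "isCont u x" for x
  proof -
    define e where "e y = norm (r y - r x - (\<Sum>b\<in>Basis. (u x \<bullet> b) *\<^sub>R (c b y - c b x)))" for y
    have c: "isCont (c b) x" if "b \<in> Basis" for b
      using 0(1)[OF that] by (auto simp: continuous_on_eq_continuous_at)
    have r: "isCont r x" using 0(2) by (auto simp: continuous_on_eq_continuous_at)
    have "isCont e x" unfolding e_def by (intro continuous_intros c r)
    then have "(e \<longlongrightarrow> 0) (at x)" by (simp add: isCont_def e_def)
    then have *: "((\<lambda>y. e y / \<beta>) \<longlongrightarrow> 0) (at x)" by (rule tendsto_divide_zero)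
    have "norm (u y - u x) \<le> e y / \<beta>" for y
    proof -
      have "(\<Sum>b\<in>Basis. ((u y - u x) \<bullet> b) *\<^sub>R c b y) = r y - r x - (\<Sum>b\<in>Basis. (u x \<bullet> b) *\<^sub>R (c b y - c b x))"
        unfolding 0(3)[symmetric]
        by (simp add: sum_subtractf algebra_simps)
      then have "\<beta> * norm (u y - u x) \<le> e y"
        using coercive_norm_le[OF \<beta> coercive[where w="u y - u x" and x=y]]
        unfolding e_def by simp
      then show ?thesis using \<beta> by (simp add: pos_le_divide_eq mult.commute)
    qed
    then have "((\<lambda>y. u y - u x) \<longlongrightarrow> 0) (at x)"
      by (intro Lim_null_comparison[OF _ *]) auto
    then show ?thesis by (simp add: isCont_def LIM_zero_cancel)
  qed
  ultimately show ?case by (simp add: continuous_on_eq_continuous_at)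
next
  case (Suc k)
  have Bk: "bounded_C k r" "\<And>b. b \<in> Basis \<Longrightarrow> bounded_C k (c b)"
    by (rule bounded_C_mono[OF Suc.prems(2) le_SucI[OF order_refl]],
      rule bounded_C_mono[OF Suc.prems(1) le_SucI[OF order_refl]])
  \<comment> \<open>The induction hypothesis is used twice. This first use supplies continuity of u,
    which the differentiability argument requires.\<close>
  have uk: "bounded_C k u" using Suc.IH[OF Bk(2,1) Suc.prems(3)] .
  have u: "isCont u x" for x
    using bounded_C_continuous[OF uk] by (simp add: continuous_on_eq_continuous_at)
  have cd: "c b differentiable (at x)" if "b \<in> Basis" for b x using Suc.prems(1)[OF that] by simp
  have rd: "r differentiable (at x)" for x using Suc.prems(2) by simp
  \<comment> \<open>The right-hand side of the formally differentiated system: M Du = Dr - (DM)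
    u.\<close>
  define s where "s v x = dirder v r x - (\<Sum>b\<in>Basis. (u x \<bullet> b) *\<^sub>R dirder v (c b) x)" for v x
  have key: "u differentiable (at x) \<and> (\<forall>v. (\<Sum>b\<in>Basis. (dirder v u x \<bullet> b) *\<^sub>R c b x) = s v x)" for x
  proof -
    define M where "M w = (\<Sum>b\<in>Basis. (w \<bullet> b) *\<^sub>R c b x)" for w
    have M: "linear M" unfolding M_def
      by (intro linear_compose_sum ballI linearI) (auto simp: algebra_simps)
    have "M w \<bullet> w \<le> - \<beta> * (norm w)\<^sup>2" for w
      unfolding M_def by (rule coercive)
    from linear_inverse_of_coercive[OF M \<beta> this]
    obtain N where N: "bounded_linear N" "\<And>w. N (M w) = w" "\<And>w. M (N w) = w" by blast
    \<comment> \<open>The matrix is frozen at x, so this function equals M(u(y)). Each difference of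
      coefficients vanishes at x, hence continuity of u suffices to differentiate the products
      before u is known to be differentiable.\<close>
    have "((\<lambda>y. r y - (\<Sum>b\<in>Basis. (u y \<bullet> b) *\<^sub>R (c b y - c b x))) has_derivative (\<lambda>v. s v x)) (at x)"
      unfolding s_def
    proof (intro has_derivative_diff has_derivative_sum has_derivative_dirder rd)
      fix b :: 'b assume b: "b \<in> Basis"
      have "((\<lambda>y. c b y - c b x) has_derivative (\<lambda>v. dirder v (c b) x)) (at x)"
        using has_derivative_diff[OF has_derivative_dirder[OF cd[OF b]] has_derivative_const] by simp
      then show "((\<lambda>y. (u y \<bullet> b) *\<^sub>R (c b y - c b x)) has_derivative
          (\<lambda>v. (u x \<bullet> b) *\<^sub>R dirder v (c b) x)) (at x)"
        by (intro has_derivative_scaleR_vanishing continuous_intros u) auto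
    qed
    moreover have "r y - (\<Sum>b\<in>Basis. (u y \<bullet> b) *\<^sub>R (c b y - c b x)) = M (u y)" for y
      unfolding M_def Suc.prems(3)[symmetric] by (simp add: sum_subtractf algebra_simps)
    ultimately have "((\<lambda>y. M (u y)) has_derivative (\<lambda>v. s v x)) (at x)" by simp
    from bounded_linear.has_derivative[OF N(1) this]
    have D: "(u has_derivative (\<lambda>v. N (s v x))) (at x)" by (simp add: N)
    have "M (dirder v u x) = s v x" for v
      unfolding dirder_eq[OF D] by (rule N)
    then show ?thesis using D by (auto simp: differentiable_def M_def)
  qed
  \<comment> \<open>Second use of the induction hypothesis, now for the differentiated system with
    unknown \<open>dirder v u\<close> and data \<open>s v\<close>.\<close>
  have "bounded_C k (dirder v u)" if v: "v \<in> Basis" for v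
  proof (rule Suc.IH[OF Bk(2)])
    show "bounded_C k (s v)"
      unfolding s_def using Suc.prems(1,2) v
      by (intro bounded_C_diff bounded_C_linear_combination uk) auto
  qed (use key in auto)
  then show ?case using key bounded_C_bounded[OF uk] by simp
qed

subsection \<open>Taylor expansion along a line\<close>

lemma dirder_line_derivative:
  fixes h :: "'a::real_normed_vector \<Rightarrow> 'b::real_inner"
  assumes "h differentiable (at (p + s *\<^sub>R u))"
  shows "((\<lambda>s. h (p + s *\<^sub>R u) \<bullet> b) has_real_derivative (dirder u h (p + s *\<^sub>R u) \<bullet> b)) (at s)"
proof -
  have "((\<lambda>s. p + s *\<^sub>R u) has_derivative (\<lambda>t. t *\<^sub>R u)) (at s)"
    by (auto intro!: derivative_eq_intros)
  from has_derivative_compose[OF this has_derivative_dirder[OF assms]]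
  have "((\<lambda>s. h (p + s *\<^sub>R u) \<bullet> b) has_derivative (\<lambda>t. dirder (t *\<^sub>R u) h (p + s *\<^sub>R u) \<bullet> b)) (at s)"
    by (rule has_derivative_inner_left)
  then show ?thesis
    unfolding has_field_derivative_def
    by (rule has_derivative_eq_rhs) (auto simp: linear_cmul[OF linear_dirder[OF assms]])
qed

lemma norm_le_of_components:
  fixes r :: "'b::euclidean_space" and B :: real
  assumes "\<And>b. b \<in> Basis \<Longrightarrow> \<bar>r \<bullet> b\<bar> \<le> B"
  shows "norm r \<le> DIM('b) * B"
  using order_trans[OF norm_le_l1 sum_bounded_above[of Basis "\<lambda>b. \<bar>r \<bullet> b\<bar>" B]] assms by auto

text \<open>The Lagrange remainder exists for real functions only, so it is applied to each
  component along the line; adding components costs the factor \<open>DIM('b)\<close>. The factor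
  1/2 of the remainder is absorbed in B.\<close>

lemma taylor_dirder_1:
  fixes h :: "'a::euclidean_space \<Rightarrow> 'b::euclidean_space" and \<epsilon> B :: real
  assumes d: "\<And>p. h differentiable (at p)" "\<And>p. dirder u h differentiable (at p)"
    and B: "\<And>p. norm (dirder u (dirder u h) p) \<le> B" and \<epsilon>: "\<epsilon> > 0"
  shows "norm (h (p + \<epsilon> *\<^sub>R u) - (h p + \<epsilon> *\<^sub>R dirder u h p)) \<le> DIM('b) * (B * \<epsilon>\<^sup>2)"
proof (rule norm_le_of_components)
  fix b :: 'b assume b: "b \<in> Basis"
  let ?diff = "\<lambda>m s. (dirder u ^^ m) h (p + s *\<^sub>R u) \<bullet> b"
  have "\<exists>t>0. t \<le> \<epsilon> \<and> h (p + \<epsilon> *\<^sub>R u) \<bullet> b = (\<Sum>m<2. ?diff m 0 / fact m * \<epsilon> ^ m) + ?diff 2 t / fact 2 * \<epsilon> ^ 2"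
    using d by (intro Maclaurin2[OF \<epsilon>])
      (auto simp: numeral_2_eq_2 less_Suc_eq intro!: dirder_line_derivative)
  then obtain t where t: "h (p + \<epsilon> *\<^sub>R u) \<bullet> b = (\<Sum>m<2. ?diff m 0 / fact m * \<epsilon> ^ m) + ?diff 2 t / fact 2 * \<epsilon> ^ 2"
    by blast
  have D: "\<bar>?diff 2 t\<bar> \<le> B"
    using norm_bound_Basis_le[OF b B[of "p + t *\<^sub>R u"]] by (simp add: numeral_2_eq_2)
  have eq: "(h (p + \<epsilon> *\<^sub>R u) - (h p + \<epsilon> *\<^sub>R dirder u h p)) \<bullet> b = ?diff 2 t / 2 * \<epsilon>\<^sup>2"
    unfolding inner_diff_left t by (simp add: numeral_2_eq_2 algebra_simps)
  show "\<bar>(h (p + \<epsilon> *\<^sub>R u) - (h p + \<epsilon> *\<^sub>R dirder u h p)) \<bullet> b\<bar> \<le> B * \<epsilon>\<^sup>2"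
    unfolding eq abs_mult using D by (intro mult_mono) auto
qed

lemma taylor_dirder_2:
  fixes h :: "'a::euclidean_space \<Rightarrow> 'b::euclidean_space" and \<epsilon> B :: real
  assumes d: "\<And>p. h differentiable (at p)" "\<And>p. dirder u h differentiable (at p)"
      "\<And>p. dirder u (dirder u h) differentiable (at p)"
    and B: "\<And>p. norm (dirder u (dirder u (dirder u h)) p) \<le> B" and \<epsilon>: "\<epsilon> > 0"
  shows "norm (h (p + \<epsilon> *\<^sub>R u) - (h p + \<epsilon> *\<^sub>R dirder u h p + (\<epsilon>\<^sup>2 / 2) *\<^sub>R dirder u (dirder u h) p))
    \<le> DIM('b) * (B * \<epsilon>^3)"
proof (rule norm_le_of_components)
  fix b :: 'b assume b: "b \<in> Basis"
  let ?diff = "\<lambda>m s. (dirder u ^^ m) h (p + s *\<^sub>R u) \<bullet> b"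
  have "\<exists>t>0. t \<le> \<epsilon> \<and> h (p + \<epsilon> *\<^sub>R u) \<bullet> b = (\<Sum>m<3. ?diff m 0 / fact m * \<epsilon> ^ m) + ?diff 3 t / fact 3 * \<epsilon> ^ 3"
    using d by (intro Maclaurin2[OF \<epsilon>])
      (auto simp: numeral_3_eq_3 less_Suc_eq intro!: dirder_line_derivative)
  then obtain t where t: "h (p + \<epsilon> *\<^sub>R u) \<bullet> b = (\<Sum>m<3. ?diff m 0 / fact m * \<epsilon> ^ m) + ?diff 3 t / fact 3 * \<epsilon> ^ 3"
    by blast
  have "\<bar>?diff 3 t\<bar> \<le> B"
    using norm_bound_Basis_le[OF b B[of "p + t *\<^sub>R u"]] by (simp add: numeral_3_eq_3)
  then have D: "\<bar>?diff 3 t / 6\<bar> \<le> B" by simp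
  have eq: "(h (p + \<epsilon> *\<^sub>R u) - (h p + \<epsilon> *\<^sub>R dirder u h p + (\<epsilon>\<^sup>2 / 2) *\<^sub>R dirder u (dirder u h) p)) \<bullet> b = ?diff 3 t / 6 * \<epsilon>^3"
    unfolding inner_diff_left t
    by (simp add: numeral_3_eq_3 algebra_simps fact_numeral power2_eq_square)
  show "\<bar>(h (p + \<epsilon> *\<^sub>R u) - (h p + \<epsilon> *\<^sub>R dirder u h p + (\<epsilon>\<^sup>2 / 2) *\<^sub>R dirder u (dirder u h) p)) \<bullet> b\<bar> \<le> B * \<epsilon>^3"
    unfolding eq abs_mult[of _ "\<epsilon>^3"] using D \<epsilon> by (intro mult_mono) auto
qed

subsection \<open>Matrices of partial derivatives\<close>

lemma matrix_inv_mult_vector: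
  fixes A :: "real^'n^'n"
  assumes "\<And>w. A *v w = 0 \<Longrightarrow> w = 0"
  shows "A *v (matrix_inv A *v r) = r"
proof -
  have "invertible A"
    using assms matrix_left_invertible_ker[of A] by (auto simp: invertible_left_inverse)
  then have "A ** matrix_inv A = mat 1"
    unfolding invertible_def matrix_inv_def by (rule someI2_ex) blast
  then show ?thesis by (simp add: matrix_vector_mul_assoc)
qed

text \<open>Bridge from partial derivatives of the slice y -> h(x, y) to directional derivatives of
  h on the product space, by the chain rule for \<open>Pair x\<close>.\<close>

lemma partial_component:
  fixes h :: "(real^'n) \<times> (real^'m) \<Rightarrow> real^'k"
  assumes "h differentiable (at (x, y))"
  shows "partial j (\<lambda>y. h (x, y) $ i) y = dirder (0, axis j 1) h (x, y) $ i"
proof -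
  have "(Pair x has_derivative (\<lambda>v. (0, v))) (at y)"
    by (auto intro!: derivative_eq_intros)
  from has_derivative_compose[OF this has_derivative_dirder[OF assms]]
  have "((\<lambda>y. h (x, y) $ i) has_derivative (\<lambda>v. dirder (0, v) h (x, y) $ i)) (at y)"
    by (rule bounded_linear.has_derivative[OF bounded_linear_vec_nth])
  then show ?thesis
    unfolding partial_def dirder_def[symmetric] by (rule dirder_eq)
qed

lemma linear_dirder_snd:
  assumes "h differentiable (at p)"
  shows "linear (\<lambda>w. dirder (0, w) h p)"
proof -
  have "linear (\<lambda>w::'b. (0::'a, w))" by (intro linearI) auto
  from linear_compose[OF this linear_dirder[OF assms]] show ?thesis by (simp add: o_def)
qed

lemma jac_y_mult_vector:
  fixes h :: "(real^'n) \<times> (real^'m) \<Rightarrow> real^'k"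
  assumes "h differentiable (at (x, \<gamma> x))"
  shows "jac_y h \<gamma> x *v w = dirder (0, w) h (x, \<gamma> x)"
proof -
  have "jac_y h \<gamma> x = matrix (\<lambda>w. dirder (0, w) h (x, \<gamma> x))"
    by (simp add: jac_y_def matrix_def partial_component[OF assms])
  then show ?thesis
    using matrix_works[of "\<lambda>w. dirder (0, w) h (x, \<gamma> x)"] linear_dirder_snd[OF assms]
    by (simp add: linear_def real_scaleR_def[abs_def] scalar_mult_eq_scaleR[abs_def])
qed

lemma jacobian_mult_vector:
  fixes h :: "real^'n \<Rightarrow> real^'k"
  assumes "h differentiable (at x)"
  shows "jacobian h (at x) *v w = dirder w h x"
  using dirder_eq[OF jacobian_works[THEN iffD1, OF assms]] by simp

text \<open>Expanding (0, w) along the axes in both slots turns the iterated derivative into the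
  double sum of second partials.\<close>

lemma hess_y_quadratic:
  fixes g :: "(real^'n) \<times> (real^'m) \<Rightarrow> real^'k"
  assumes d: "\<And>p. g differentiable (at p)" and d2: "\<And>u p. dirder u g differentiable (at p)"
  shows "(\<chi> i. \<Sum>j\<in>UNIV. \<Sum>k\<in>UNIV. hess_y g \<gamma> x i j k * w $ j * w $ k)
    = dirder (0, w) (dirder (0, w) g) (x, \<gamma> x)"
proof -
  have h: "hess_y g \<gamma> x i j k = dirder (0, axis j 1) (dirder (0, axis k 1) g) (x, \<gamma> x) $ i" for i j k
    unfolding hess_y_def partial_component[OF d] partial_component[OF d2] ..
  have w: "(0, w) = (\<Sum>j\<in>UNIV. w $ j *\<^sub>R (0::real^'n, axis j 1 :: real^'m))"
  proof -
    have "(\<Sum>j\<in>UNIV. w $ j *\<^sub>R axis j 1) = w"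
      using basis_expansion[of w] by (simp add: scalar_mult_eq_scaleR)
    then show ?thesis by (simp add: prod_eq_iff fst_sum snd_sum)
  qed
  have 1: "dirder (0, w) k p = (\<Sum>j\<in>UNIV. w $ j *\<^sub>R dirder (0, axis j 1) k p)"
    if "k differentiable (at p)" for k :: "(real^'n) \<times> (real^'m) \<Rightarrow> real^'k" and p
    by (subst w, subst linear_sum[OF linear_dirder[OF that]])
      (simp add: linear_cmul[OF linear_dirder[OF that]] del: scaleR_Pair)
  have "dirder (0, w) g = (\<lambda>q. \<Sum>k\<in>UNIV. w $ k *\<^sub>R dirder (0, axis k 1) g q)"
    by (intro ext 1 d)
  then have "dirder (0, w) (dirder (0, w) g) (x, \<gamma> x)
      = (\<Sum>k\<in>UNIV. w $ k *\<^sub>R dirder (0, w) (dirder (0, axis k 1) g) (x, \<gamma> x))"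
    by (simp, intro dirder_eq has_derivative_sum has_derivative_scaleR_right has_derivative_dirder d2)
  also have "\<dots> = (\<Sum>k\<in>UNIV. \<Sum>j\<in>UNIV. (w $ k * w $ j) *\<^sub>R
      dirder (0, axis j 1) (dirder (0, axis k 1) g) (x, \<gamma> x))"
    by (subst 1[OF d2]) (simp add: scaleR_sum_right)
  finally have Q: "dirder (0, w) (dirder (0, w) g) (x, \<gamma> x) = \<dots>" .
  show ?thesis
    unfolding Q vec_eq_iff h
    \<comment> \<open>Expanding the inner direction first puts the sum over k outside, whereas
      \<open>hess_y\<close> is summed with j outside.\<close>
    by (subst sum.swap) (simp add: mult_ac)
qed

subsection \<open>The slow manifold and its correctors\<close>

text \<open>The level 2 is counted from \<open>f\<close> itself but from the first derivatives of
  \<open>g\<close>: the residual estimate needs a Taylor remainder of second order for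
  \<open>f\<close> and of third order for \<open>g\<close>.\<close>

locale slow_fast =
  fixes f :: "(real^'n::finite) \<times> (real^'m::finite) \<Rightarrow> real^'n"
    and g :: "(real^'n) \<times> (real^'m) \<Rightarrow> real^'m"
    and \<gamma> :: "real^'n \<Rightarrow> real^'m"
    and \<beta> :: real
  assumes f_bounded_C: "bounded_C 2 f"
    and g_diff: "\<And>p. g differentiable (at p)"
    and g_bounded_C: "\<And>b. b \<in> Basis \<Longrightarrow> bounded_C 2 (dirder b g)"
    and g_zero: "\<And>x. g (x, \<gamma> x) = 0"
    and \<beta>_pos: "\<beta> > 0"
    and monotone: "\<And>x y y'. (g (x, y) - g (x, y')) \<bullet> (y - y') \<le> - \<beta> * (norm (y - y'))\<^sup>2"
begin

lemma f_diff: "f differentiable (at p)"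
  by (rule bounded_C_differentiable[OF f_bounded_C]) simp

lemma f_dirder_bounded_C: "bounded_C 1 (dirder v f)"
  by (rule bounded_C_dirder_Suc) (use f_bounded_C in \<open>simp only: Suc_1\<close>)

lemma g_dirder_bounded_C: "bounded_C 2 (dirder v g)"
  by (rule bounded_C_dirder[OF g_diff g_bounded_C])

lemma g_dirder_diff: "dirder v g differentiable (at p)"
  by (rule bounded_C_differentiable[OF g_dirder_bounded_C]) simp

lemma g_dirder2_bounded_C: "bounded_C 1 (dirder u (dirder v g))"
  by (rule bounded_C_dirder_Suc) (use g_dirder_bounded_C in \<open>simp only: Suc_1\<close>)

lemma g_dirder2_diff: "dirder u (dirder v g) differentiable (at p)"
  by (rule bounded_C_differentiable[OF g_dirder2_bounded_C]) simp

lemma f_Lipschitz: obtains L where "L > 0" "\<And>p q. norm (f p - f q) \<le> L * norm (p - q)"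
  using bounded_C_dirder_Lipschitz[OF f_diff bounded_C_bounded[OF f_dirder_bounded_C]] by metis

lemma g_Lipschitz: obtains L where "L > 0" "\<And>p q. norm (g p - g q) \<le> L * norm (p - q)"
  using bounded_C_dirder_Lipschitz[OF g_diff bounded_C_bounded[OF g_dirder_bounded_C]] by metis

text \<open>The difference quotients of monotonicity in the direction w pass to the limit. Taking s
  > 0 preserves the inequality under division by s.\<close>

lemma dirder_snd_coercive: "dirder (0, w) g p \<bullet> w \<le> - \<beta> * (norm w)\<^sup>2"
proof -
  have "((\<lambda>s. g (p + s *\<^sub>R (0, w)) \<bullet> w) has_real_derivative (dirder (0, w) g p \<bullet> w)) (at 0)"
    using dirder_line_derivative[of g p 0 "(0, w)" w, OF g_diff]
    unfolding scaleR_zero_left add_0_right .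
  then have "((\<lambda>s. (g (p + s *\<^sub>R (0, w)) \<bullet> w - g p \<bullet> w) / s) \<longlongrightarrow> dirder (0, w) g p \<bullet> w) (at 0)"
    unfolding DERIV_def add_0_left scaleR_zero_left add_0_right .
  then have lim: "((\<lambda>s. (g (p + s *\<^sub>R (0, w)) \<bullet> w - g p \<bullet> w) / s) \<longlongrightarrow> dirder (0, w) g p \<bullet> w) (at_right 0)"
    by (rule filterlim_mono) (auto intro: at_le)
  have "(g (p + s *\<^sub>R (0, w)) \<bullet> w - g p \<bullet> w) / s \<le> - \<beta> * (norm w)\<^sup>2" if "s > 0" for s
  proof -
    obtain x y where p: "p = (x, y)" by force
    \<comment> \<open>Monotonicity for the displacement s w carries one factor s on the left and two
      on the right; one is cancelled next.\<close>
    have "s * (g (x, y + s *\<^sub>R w) \<bullet> w - g (x, y) \<bullet> w) \<le> s * (s * (- \<beta> * (norm w)\<^sup>2))"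
      using monotone[of x "y + s *\<^sub>R w" y] by (simp add: inner_diff_left power2_eq_square algebra_simps)
    then have "g (x, y + s *\<^sub>R w) \<bullet> w - g (x, y) \<bullet> w \<le> s * (- \<beta> * (norm w)\<^sup>2)"
      using that mult_le_cancel_left_pos by blast
    then show ?thesis using that by (simp add: p divide_le_eq mult.commute)
  qed
  then show ?thesis
    by (intro tendsto_upperbound[OF lim] eventually_at_rightI[of 0 1]) auto
qed

lemma dirder_snd_sum_Basis:
  "(\<Sum>b\<in>Basis. (w \<bullet> b) *\<^sub>R dirder (0, b) g p) = dirder (0, w) g p"
proof -
  have "dirder (0, \<Sum>b\<in>Basis. (w \<bullet> b) *\<^sub>R b) g p = (\<Sum>b\<in>Basis. (w \<bullet> b) *\<^sub>R dirder (0, b) g p)"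
    by (subst linear_sum[OF linear_dirder_snd[OF g_diff]])
      (simp add: linear_cmul[OF linear_dirder_snd[OF g_diff]])
  then show ?thesis by (simp add: euclidean_representation)
qed

text \<open>By monotonicity the distance from \<gamma>(x') to the zero \<gamma>(x) is at most |g(x,
  \<gamma>(x'))|/\<beta>, and this value is close to g(x', \<gamma>(x')) = 0 by the Lipschitz bound
  on \<open>g\<close>. No regularity of \<open>\<gamma>\<close> enters.\<close>

lemma \<gamma>_Lipschitz: obtains L where "L > 0" "\<And>x x'. norm (\<gamma> x - \<gamma> x') \<le> L * norm (x - x')"
proof -
  obtain L where L: "L > 0" "\<And>p q. norm (g p - g q) \<le> L * norm (p - q)"
    by (rule g_Lipschitz) blast
  have "norm (\<gamma> x - \<gamma> x') \<le> (L / \<beta>) * norm (x - x')" for x x'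
  proof -
    have "\<beta> * norm (\<gamma> x - \<gamma> x') \<le> norm (g (x, \<gamma> x) - g (x, \<gamma> x'))"
      by (rule coercive_norm_le[OF \<beta>_pos monotone])
    also have "\<dots> = norm (g (x', \<gamma> x') - g (x, \<gamma> x'))" by (simp add: g_zero)
    also have "\<dots> \<le> L * norm ((x', \<gamma> x') - (x, \<gamma> x'))" by (rule L)
    also have "\<dots> = L * norm (x - x')" by (simp add: norm_Pair norm_minus_commute)
    finally show ?thesis using \<beta>_pos by (simp add: field_simps)
  qed
  then show ?thesis using that[of "L / \<beta>"] L \<beta>_pos by simp
qed

text \<open>Implicit differentiation for the given global \<open>\<gamma>\<close>: its Lipschitz
  bound makes the remainder of \<open>g\<close> along the graph o(|y - x|), and the coercive
  y-derivative of \<open>g\<close> is then inverted.\<close>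

lemma \<gamma>_has_derivative:
  obtains \<gamma>' where "(\<gamma> has_derivative \<gamma>') (at x)"
    "\<And>v. dirder (0, \<gamma>' v) g (x, \<gamma> x) = - dirder (v, 0) g (x, \<gamma> x)"
proof -
  define M where "M w = dirder (0, w) g (x, \<gamma> x)" for w
  have M: "linear M" unfolding M_def by (rule linear_dirder_snd[OF g_diff])
  have "M w \<bullet> w \<le> - \<beta> * (norm w)\<^sup>2" for w unfolding M_def by (rule dirder_snd_coercive)
  from linear_inverse_of_coercive[OF M \<beta>_pos this]
  obtain N where N: "bounded_linear N" "\<And>w. N (M w) = w" "\<And>w. M (N w) = w" by blast
  obtain L where L: "L > 0" "\<And>x x'. norm (\<gamma> x - \<gamma> x') \<le> L * norm (x - x')"
    by (rule \<gamma>_Lipschitz) blast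
  \<comment> \<open>As \<open>g\<close> vanishes on the graph, this linearization of
    \<open>g\<close> is, up to sign, the first-order remainder of \<open>g\<close>; so it has
    derivative 0 at x.\<close>
  define R where "R y = dirder (y - x, \<gamma> y - \<gamma> x) g (x, \<gamma> x)" for y
  have "(R has_derivative (\<lambda>v. 0)) (at x)"
    unfolding has_derivative_at_alt
  proof (intro conjI allI impI)
    fix e :: real assume e: "e > 0"
    then have "e / (1 + L) > 0" using L by simp
    then obtain d where d: "d > 0" "\<And>q. norm (q - (x, \<gamma> x)) < d \<Longrightarrow>
        norm (g q - g (x, \<gamma> x) - dirder (q - (x, \<gamma> x)) g (x, \<gamma> x)) \<le> e / (1 + L) * norm (q - (x, \<gamma> x))"
      using has_derivative_dirder[OF g_diff, of "(x, \<gamma> x)"] unfolding has_derivative_at_alt by metis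
    show "\<exists>d>0. \<forall>y. norm (y - x) < d \<longrightarrow> norm (R y - R x - 0) \<le> e * norm (y - x)"
    \<comment> \<open>The graph map has Lipschitz constant at most 1 + L, so this radius keeps graph
      points within distance d.\<close>
    proof (intro exI[of _ "d / (1 + L)"] conjI allI impI)
      fix y assume y: "norm (y - x) < d / (1 + L)"
      have "norm ((y, \<gamma> y) - (x, \<gamma> x)) \<le> norm (y - x) + norm (\<gamma> y - \<gamma> x)"
        using norm_Pair_le[of "y - x" "\<gamma> y - \<gamma> x"] by simp
      also have "\<dots> \<le> (1 + L) * norm (y - x)" using L(2)[of y x] by (simp add: algebra_simps)
      finally have 1: "norm ((y, \<gamma> y) - (x, \<gamma> x)) \<le> (1 + L) * norm (y - x)" .
      also have "\<dots> < d" using y L by (simp add: field_simps)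
      finally have "norm (R y) \<le> e / (1 + L) * norm ((y, \<gamma> y) - (x, \<gamma> x))"
        using d(2)[of "(y, \<gamma> y)"] by (simp add: R_def g_zero)
      also have "\<dots> \<le> e / (1 + L) * ((1 + L) * norm (y - x))"
        using 1 e L by (intro mult_left_mono) auto
      finally have "norm (R y) \<le> e * norm (y - x)" using L by simp
      moreover have "R x = 0"
        using linear_0[OF linear_dirder[OF g_diff, of "(x, \<gamma> x)"]] by (simp add: R_def zero_prod_def)
      ultimately show "norm (R y - R x - 0) \<le> e * norm (y - x)" by simp
    qed (use d L in auto)
  qed simp
  moreover have "((\<lambda>y. dirder (y - x, 0) g (x, \<gamma> x)) has_derivative (\<lambda>v. dirder (v, 0) g (x, \<gamma> x))) (at x)"
  proof -
    have 1: "bounded_linear (\<lambda>v. dirder v g (x, \<gamma> x))"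
      using linear_conv_bounded_linear linear_dirder[OF g_diff] by blast
    have "((\<lambda>y. (y - x, 0)) has_derivative (\<lambda>v. (v, 0))) (at x)"
      by (auto intro!: derivative_eq_intros)
    from bounded_linear.has_derivative[OF 1 this] show ?thesis .
  qed
  ultimately have "((\<lambda>y. R y - dirder (y - x, 0) g (x, \<gamma> x)) has_derivative
      (\<lambda>v. 0 - dirder (v, 0) g (x, \<gamma> x))) (at x)"
    by (rule has_derivative_diff)
  moreover have "R y - dirder (y - x, 0) g (x, \<gamma> x) = M (\<gamma> y - \<gamma> x)" for y
  proof -
    have "R y = dirder ((y - x, 0) + (0, \<gamma> y - \<gamma> x)) g (x, \<gamma> x)" by (simp add: R_def)
    then show ?thesis
      unfolding linear_add[OF linear_dirder[OF g_diff]] by (simp add: M_def)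
  qed
  ultimately have "((\<lambda>y. M (\<gamma> y - \<gamma> x)) has_derivative (\<lambda>v. - dirder (v, 0) g (x, \<gamma> x))) (at x)"
    by simp
  from bounded_linear.has_derivative[OF N(1) this]
  have "((\<lambda>y. \<gamma> y - \<gamma> x) has_derivative (\<lambda>v. N (- dirder (v, 0) g (x, \<gamma> x)))) (at x)"
    by (simp add: N)
  from has_derivative_add[OF this has_derivative_const[of "\<gamma> x"]]
  have "(\<gamma> has_derivative (\<lambda>v. N (- dirder (v, 0) g (x, \<gamma> x)))) (at x)" by simp
  moreover have "dirder (0, N (- dirder (v, 0) g (x, \<gamma> x))) g (x, \<gamma> x) = - dirder (v, 0) g (x, \<gamma> x)" for v
    using N(3)[of "- dirder (v, 0) g (x, \<gamma> x)"] by (simp add: M_def)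
  ultimately show ?thesis by (rule that)
qed

lemma \<gamma>_diff: "\<gamma> differentiable (at x)"
  by (rule \<gamma>_has_derivative) (rule differentiableI)

lemma dirder_\<gamma>: "dirder (0, dirder v \<gamma> x) g (x, \<gamma> x) = - dirder (v, 0) g (x, \<gamma> x)"
  by (rule \<gamma>_has_derivative[of x]) (simp add: dirder_eq)

lemma bounded_C_on_graph':
  assumes "bounded_C k h" "\<And>j v. j < k \<Longrightarrow> v \<in> Basis \<Longrightarrow> bounded_C j (dirder v \<gamma>)"
  shows "bounded_C k (\<lambda>x. h (x, \<gamma> x))"
proof (rule bounded_C_compose[OF _ assms(1)])
  have D: "((\<lambda>x. (x, \<gamma> x)) has_derivative (\<lambda>v. (v, dirder v \<gamma> x))) (at x)" for x
    by (intro has_derivative_Pair has_derivative_ident has_derivative_dirder \<gamma>_diff)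
  then show "(\<lambda>x. (x, \<gamma> x)) differentiable (at x)" for x by (rule differentiableI)
  fix j and v :: "real^'n" assume jv: "j < k" "v \<in> Basis"
  have "bounded_C j (\<lambda>x. (v, 0) + (0, dirder v \<gamma> x))"
    by (intro bounded_C_add bounded_C_const bounded_C_linear[OF _ assms(2)] jv
        bounded_linear_Pair bounded_linear_zero bounded_linear_ident)
  then show "bounded_C j (dirder v (\<lambda>x. (x, \<gamma> x)))"
    by (simp add: dirder_eq[OF D, abs_def] ext[OF dirder_eq[OF D]])
qed

lemma bounded_C_solve_dirder:
  assumes "\<And>b. b \<in> Basis \<Longrightarrow> bounded_C k (\<lambda>x. dirder (0, b) g (x, \<gamma> x))" "bounded_C k r"
    and "\<And>x. dirder (0, u x) g (x, \<gamma> x) = r x"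
  shows "bounded_C k u"
proof (rule bounded_C_solve[OF \<beta>_pos _ assms(1,2)])
  show "(\<Sum>b\<in>Basis. (w \<bullet> b) *\<^sub>R dirder (0, b) g (x, \<gamma> x)) \<bullet> w \<le> - \<beta> * (norm w)\<^sup>2" for x w
    unfolding dirder_snd_sum_Basis by (rule dirder_snd_coercive)
  show "(\<Sum>b\<in>Basis. (u x \<bullet> b) *\<^sub>R dirder (0, b) g (x, \<gamma> x)) = r x" for x
    unfolding dirder_snd_sum_Basis by (rule assms)
qed

text \<open>Bootstrapping: the derivative of \<open>\<gamma>\<close> solves a system with
  coefficients on the graph, and these are in class k as soon as the derivative of
  \<open>\<gamma>\<close> is in every lower class. The cap 2 is the class of the derivatives of
  \<open>g\<close>.\<close>

lemma bounded_C_dirder_\<gamma>_aux: "k \<le> 2 \<Longrightarrow> bounded_C k (dirder v \<gamma>)"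
proof (induction k arbitrary: v rule: less_induct)
  case (less k)
  have c: "bounded_C k (\<lambda>x. dirder w g (x, \<gamma> x))" for w
    using less by (intro bounded_C_on_graph' bounded_C_mono[OF g_dirder_bounded_C]) auto
  have "bounded_C k (\<lambda>x. - dirder (v, 0) g (x, \<gamma> x))"
    by (rule bounded_C_linear[OF bounded_linear_minus[OF bounded_linear_ident] c])
  with c show ?case by (rule bounded_C_solve_dirder) (rule dirder_\<gamma>)
qed

lemma bounded_C_dirder_\<gamma>: "bounded_C 2 (dirder v \<gamma>)"
  by (simp add: bounded_C_dirder_\<gamma>_aux)

lemma bounded_C_on_graph: "bounded_C k h \<Longrightarrow> k \<le> 2 \<Longrightarrow> bounded_C k (\<lambda>x. h (x, \<gamma> x))"
  by (intro bounded_C_on_graph' bounded_C_dirder_\<gamma>_aux) auto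

lemma matrix_inv_jac_y: "dirder (0, matrix_inv (jac_y g \<gamma> x) *v r) g (x, \<gamma> x) = r"
proof -
  have "w = 0" if "jac_y g \<gamma> x *v w = 0" for w
  proof -
    have "\<beta> * norm w \<le> norm (dirder (0, w) g (x, \<gamma> x))"
      by (rule coercive_norm_le[OF \<beta>_pos dirder_snd_coercive])
    then show ?thesis using that \<beta>_pos by (simp add: jac_y_mult_vector[OF g_diff] mult_le_0_iff)
  qed
  then have "jac_y g \<gamma> x *v (matrix_inv (jac_y g \<gamma> x) *v r) = r"
    by (rule matrix_inv_mult_vector)
  then show ?thesis unfolding jac_y_mult_vector[OF g_diff] .
qed

section \<open>Linear equations and regularity for the two correctors\<close>

abbreviation "\<gamma>\<^sub>1 \<equiv> gamma1 f g \<gamma>"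
abbreviation "\<gamma>\<^sub>2 \<equiv> gamma2 f g \<gamma>"

text \<open>The defining formula with the inverse matrix removed; this is the order \<epsilon>
  balance of the invariance equation.\<close>

lemma gamma1_eq: "dirder (0, \<gamma>\<^sub>1 x) g (x, \<gamma> x) = dirder (f (x, \<gamma> x)) \<gamma> x"
  unfolding gamma1_def matrix_inv_jac_y jacobian_mult_vector[OF \<gamma>_diff] slow_F_def ..

lemma bounded_C_gamma1: "bounded_C 2 \<gamma>\<^sub>1"
proof (rule bounded_C_solve_dirder[OF _ _ gamma1_eq])
  show "bounded_C 2 (\<lambda>x. dirder (0, b) g (x, \<gamma> x))" for b
    by (intro bounded_C_on_graph g_dirder_bounded_C) simp
  show "bounded_C 2 (\<lambda>x. dirder (f (x, \<gamma> x)) \<gamma> x)"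
    by (rule bounded_C_dirder_at[OF \<gamma>_diff bounded_C_dirder_\<gamma> bounded_C_on_graph[OF f_bounded_C]]) simp
qed

lemma gamma1_diff: "\<gamma>\<^sub>1 differentiable (at x)"
  by (rule bounded_C_differentiable[OF bounded_C_gamma1]) simp

lemma bounded_C_dirder_gamma1: "bounded_C 1 (dirder v \<gamma>\<^sub>1)"
  by (rule bounded_C_dirder_Suc) (use bounded_C_gamma1 in \<open>simp only: Suc_1\<close>)

text \<open>The order \<epsilon>^2 balance of the invariance equation; the factor 1/2 is the Taylor
  coefficient of the quadratic term of \<open>g\<close>.\<close>

lemma gamma2_eq: "dirder (0, \<gamma>\<^sub>2 x) g (x, \<gamma> x) =
  dirder (dirder (0, \<gamma>\<^sub>1 x) f (x, \<gamma> x)) \<gamma> x + dirder (f (x, \<gamma> x)) \<gamma>\<^sub>1 x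
    - (1/2) *\<^sub>R dirder (0, \<gamma>\<^sub>1 x) (dirder (0, \<gamma>\<^sub>1 x) g) (x, \<gamma> x)"
  unfolding gamma2_def matrix_inv_jac_y jacobian_mult_vector[OF \<gamma>_diff]
    jacobian_mult_vector[OF gamma1_diff] slow_F_def jac_y_mult_vector[OF f_diff]
    hess_y_quadratic[OF g_diff g_dirder_diff] ..

text \<open>One class below \<open>\<gamma>\<^sub>1\<close>, because the right-hand side contains
  the first derivatives of \<open>f\<close> and \<open>\<gamma>\<^sub>1\<close> and the second
  derivative of \<open>g\<close>, all of class 1.\<close>

lemma bounded_C_gamma2: "bounded_C 1 \<gamma>\<^sub>2"
proof (rule bounded_C_solve_dirder[OF _ _ gamma2_eq])
  have \<gamma>1: "bounded_C 1 \<gamma>\<^sub>1" by (rule bounded_C_mono[OF bounded_C_gamma1]) simp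
  have F: "bounded_C 1 (\<lambda>x. f (x, \<gamma> x))"
    by (rule bounded_C_on_graph[OF bounded_C_mono[OF f_bounded_C]]) auto
  have w: "bounded_C 1 (\<lambda>x. (0 :: real^'n, \<gamma>\<^sub>1 x))"
    by (intro bounded_C_linear[OF _ \<gamma>1] bounded_linear_Pair bounded_linear_zero bounded_linear_ident)
  have "bounded_C 1 (\<lambda>x. dirder (0, \<gamma>\<^sub>1 x) f (x, \<gamma> x))"
    by (rule bounded_C_dirder_at[OF f_diff bounded_C_on_graph[OF f_dirder_bounded_C] w]) simp
  then have 1: "bounded_C 1 (\<lambda>x. dirder (dirder (0, \<gamma>\<^sub>1 x) f (x, \<gamma> x)) \<gamma> x)"
    by (rule bounded_C_dirder_at[OF \<gamma>_diff bounded_C_mono[OF bounded_C_dirder_\<gamma>], rotated]) simp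
  have 2: "bounded_C 1 (\<lambda>x. dirder (f (x, \<gamma> x)) \<gamma>\<^sub>1 x)"
    by (rule bounded_C_dirder_at[OF gamma1_diff bounded_C_dirder_gamma1 F])
  \<comment> \<open>The inner direction moves with x, so
    \<open>dirder (0, \<gamma>\<^sub>1 x) g\<close> is not one fixed function evaluated on the
    graph; expanding it reduces to the fixed functions \<open>dirder b g\<close>.\<close>
  have "bounded_C 1 (\<lambda>x. \<Sum>b\<in>Basis. ((0, \<gamma>\<^sub>1 x) \<bullet> b) *\<^sub>R dirder (0, \<gamma>\<^sub>1 x) (dirder b g) (x, \<gamma> x))"
    by (intro bounded_C_linear_combination w bounded_C_dirder_at[OF g_dirder_diff _ w]
        bounded_C_on_graph g_dirder2_bounded_C) simp
  then have 3: "bounded_C 1 (\<lambda>x. dirder (0, \<gamma>\<^sub>1 x) (dirder (0, \<gamma>\<^sub>1 x) g) (x, \<gamma> x))"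
    by (subst dirder_dirder_sum_Basis[OF g_diff g_dirder_diff])
  show "bounded_C 1 (\<lambda>x. dirder (dirder (0, \<gamma>\<^sub>1 x) f (x, \<gamma> x)) \<gamma> x + dirder (f (x, \<gamma> x)) \<gamma>\<^sub>1 x
    - (1/2) *\<^sub>R dirder (0, \<gamma>\<^sub>1 x) (dirder (0, \<gamma>\<^sub>1 x) g) (x, \<gamma> x))"
    by (intro bounded_C_diff bounded_C_add 1 2 bounded_C_scaleR bounded_C_const 3)
  show "bounded_C 1 (\<lambda>x. dirder (0, b) g (x, \<gamma> x))" for b
    by (intro bounded_C_on_graph bounded_C_mono[OF g_dirder_bounded_C]) auto
qed

lemma gamma2_diff: "\<gamma>\<^sub>2 differentiable (at x)"
  by (rule bounded_C_differentiable[OF bounded_C_gamma2]) simp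

lemma bounded_C_dirder_gamma2: "bounded_C 0 (dirder v \<gamma>\<^sub>2)"
  by (rule bounded_C_dirder_Suc) (use bounded_C_gamma2 in \<open>simp only: One_nat_def\<close>)

section \<open>Uniform bounds, Taylor expansions and the invariance residual of the corrected
  manifold\<close>

abbreviation "\<Gamma> \<epsilon> x \<equiv> Gamma2 f g \<gamma> x \<epsilon>"

definition d\<Gamma> :: "real \<Rightarrow> real^'n \<Rightarrow> real^'n \<Rightarrow> real^'m" where
  "d\<Gamma> \<epsilon> x v = dirder v \<gamma> x + \<epsilon> *\<^sub>R dirder v \<gamma>\<^sub>1 x + \<epsilon>\<^sup>2 *\<^sub>R dirder v \<gamma>\<^sub>2 x"

lemma Gamma2_has_derivative: "(\<Gamma> \<epsilon> has_derivative d\<Gamma> \<epsilon> x) (at x)"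
  unfolding Gamma2_def d\<Gamma>_def[abs_def]
  by (intro has_derivative_add has_derivative_scaleR_right has_derivative_dirder
      \<gamma>_diff gamma1_diff gamma2_diff)

lemma dirder_\<gamma>s_bound:
  obtains L where "L > 0" "\<And>v x. norm (dirder v \<gamma> x) \<le> L * norm v"
    "\<And>v x. norm (dirder v \<gamma>\<^sub>1 x) \<le> L * norm v" "\<And>v x. norm (dirder v \<gamma>\<^sub>2 x) \<le> L * norm v"
proof -
  obtain L0 where L0: "L0 > 0" "\<And>x v. norm (dirder v \<gamma> x) \<le> L0 * norm v"
    by (rule bounded_C_dirder_Lipschitz[OF \<gamma>_diff bounded_C_bounded[OF bounded_C_dirder_\<gamma>]]) (rule that)
  obtain L1 where L1: "L1 > 0" "\<And>x v. norm (dirder v \<gamma>\<^sub>1 x) \<le> L1 * norm v"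
    by (rule bounded_C_dirder_Lipschitz[OF gamma1_diff bounded_C_bounded[OF bounded_C_dirder_gamma1]]) (rule that)
  obtain L2 where L2: "L2 > 0" "\<And>x v. norm (dirder v \<gamma>\<^sub>2 x) \<le> L2 * norm v"
    by (rule bounded_C_dirder_Lipschitz[OF gamma2_diff bounded_C_bounded[OF bounded_C_dirder_gamma2]]) (rule that)
  show ?thesis
  proof (rule that[of "L0 + L1 + L2"])
    show "norm (dirder v \<gamma> x) \<le> (L0 + L1 + L2) * norm v" for v x
      by (rule order_trans[OF L0(2) mult_right_mono]) (use L0(1) L1(1) L2(1) in auto)
    show "norm (dirder v \<gamma>\<^sub>1 x) \<le> (L0 + L1 + L2) * norm v" for v x
      by (rule order_trans[OF L1(2) mult_right_mono]) (use L0(1) L1(1) L2(1) in auto)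
    show "norm (dirder v \<gamma>\<^sub>2 x) \<le> (L0 + L1 + L2) * norm v" for v x
      by (rule order_trans[OF L2(2) mult_right_mono]) (use L0(1) L1(1) L2(1) in auto)
  qed (use L0(1) L1(1) L2(1) in auto)
qed

lemma d\<Gamma>_bound:
  obtains L where "L > 0" "\<And>\<epsilon> v x. 0 < \<epsilon> \<Longrightarrow> \<epsilon> \<le> 1 \<Longrightarrow> norm (d\<Gamma> \<epsilon> x v) \<le> L * norm v"
proof -
  obtain L where L: "L > 0" "\<And>v x. norm (dirder v \<gamma> x) \<le> L * norm v"
    "\<And>v x. norm (dirder v \<gamma>\<^sub>1 x) \<le> L * norm v" "\<And>v x. norm (dirder v \<gamma>\<^sub>2 x) \<le> L * norm v"
    by (rule dirder_\<gamma>s_bound) (rule that)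
  have "norm (d\<Gamma> \<epsilon> x v) \<le> (3 * L) * norm v" if \<epsilon>: "0 < \<epsilon>" "\<epsilon> \<le> 1" for \<epsilon> v x
  proof -
    have "norm (d\<Gamma> \<epsilon> x v) \<le> norm (dirder v \<gamma> x) + norm (\<epsilon> *\<^sub>R dirder v \<gamma>\<^sub>1 x) + norm (\<epsilon>\<^sup>2 *\<^sub>R dirder v \<gamma>\<^sub>2 x)"
      unfolding d\<Gamma>_def by (meson add_right_mono norm_triangle_ineq norm_triangle_le)
    also have "norm (\<epsilon> *\<^sub>R dirder v \<gamma>\<^sub>1 x) \<le> 1 * (L * norm v)"
      unfolding norm_scaleR using \<epsilon> L by (intro mult_mono) auto
    also have "norm (\<epsilon>\<^sup>2 *\<^sub>R dirder v \<gamma>\<^sub>2 x) \<le> 1 * (L * norm v)"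
      unfolding norm_scaleR using \<epsilon> L by (intro mult_mono) (auto simp: power_le_one)
    finally show ?thesis using L(2)[of v x] by simp
  qed
  then show ?thesis using that[of "3 * L"] L(1) by simp
qed

lemma Gamma2_Lipschitz:
  obtains L where "L > 0" "\<And>\<epsilon> x x'. 0 < \<epsilon> \<Longrightarrow> \<epsilon> \<le> 1 \<Longrightarrow> norm (\<Gamma> \<epsilon> x - \<Gamma> \<epsilon> x') \<le> L * norm (x - x')"
proof -
  obtain L where L: "L > 0" "\<And>\<epsilon> v x. 0 < \<epsilon> \<Longrightarrow> \<epsilon> \<le> 1 \<Longrightarrow> norm (d\<Gamma> \<epsilon> x v) \<le> L * norm v"
    by (rule d\<Gamma>_bound) (rule that)
  have "norm (\<Gamma> \<epsilon> x - \<Gamma> \<epsilon> x') \<le> L * norm (x - x')" if "0 < \<epsilon>" "\<epsilon> \<le> 1" for \<epsilon> x x'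
  proof (rule differentiable_bound[of UNIV "\<Gamma> \<epsilon>" "d\<Gamma> \<epsilon>"])
    show "onorm (d\<Gamma> \<epsilon> x) \<le> L" for x by (rule onorm_le) (rule L(2)[OF that])
  qed (simp_all add: Gamma2_has_derivative)
  with L(1) show ?thesis by (rule that)
qed

text \<open>Displays the displacement from \<gamma>(x) as \<epsilon> times one bounded direction,
  the form in which Taylor expansion along a line applies.\<close>

lemma Gamma2_eq: "\<Gamma> \<epsilon> x = \<gamma> x + \<epsilon> *\<^sub>R (\<gamma>\<^sub>1 x + \<epsilon> *\<^sub>R \<gamma>\<^sub>2 x)"
  by (simp add: Gamma2_def algebra_simps power2_eq_square)

lemma corrector_bound:
  obtains U where "U \<ge> 0" "\<And>x. norm (\<gamma>\<^sub>1 x) \<le> U" "\<And>x. norm (\<gamma>\<^sub>2 x) \<le> U"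
    "\<And>\<epsilon> x. 0 < \<epsilon> \<Longrightarrow> \<epsilon> \<le> 1 \<Longrightarrow> norm (\<gamma>\<^sub>1 x + \<epsilon> *\<^sub>R \<gamma>\<^sub>2 x) \<le> U"
proof -
  obtain B1 where B1: "B1 \<ge> 0" "\<And>x. norm (\<gamma>\<^sub>1 x) \<le> B1" by (rule bounded_C_norm_le[OF bounded_C_gamma1]) (rule that)
  obtain B2 where B2: "B2 \<ge> 0" "\<And>x. norm (\<gamma>\<^sub>2 x) \<le> B2" by (rule bounded_C_norm_le[OF bounded_C_gamma2]) (rule that)
  have "norm (\<gamma>\<^sub>1 x + \<epsilon> *\<^sub>R \<gamma>\<^sub>2 x) \<le> B1 + B2" if "0 < \<epsilon>" "\<epsilon> \<le> 1" for \<epsilon> x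
  proof -
    have "norm (\<epsilon> *\<^sub>R \<gamma>\<^sub>2 x) \<le> 1 * B2" unfolding norm_scaleR using that B2 by (intro mult_mono) auto
    then show ?thesis using norm_triangle_ineq[of "\<gamma>\<^sub>1 x" "\<epsilon> *\<^sub>R \<gamma>\<^sub>2 x"] B1(2)[of x] by linarith
  qed
  then show ?thesis
    using B1 B2 by (intro that[of "B1 + B2"]) (auto intro: add_increasing add_increasing2)
qed

lemma dirder_corrector:
  assumes "h differentiable (at p)"
  shows "dirder (0, \<gamma>\<^sub>1 x + \<epsilon> *\<^sub>R \<gamma>\<^sub>2 x) h p = dirder (0, \<gamma>\<^sub>1 x) h p + \<epsilon> *\<^sub>R dirder (0, \<gamma>\<^sub>2 x) h p"
  using linear_add[OF linear_dirder_snd[OF assms]] linear_cmul[OF linear_dirder_snd[OF assms]] by simp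

text \<open>Expansion along
  \<open>\<gamma>\<^sub>1 x + \<epsilon> *\<^sub>R \<gamma>\<^sub>2 x\<close>; the contribution of
  \<open>\<gamma>\<^sub>2\<close> to the linear term is already of order \<epsilon>^2 and joins the
  error.\<close>

lemma f_expansion:
  obtains C where "C \<ge> 0" "\<And>\<epsilon> x. 0 < \<epsilon> \<Longrightarrow> \<epsilon> \<le> 1 \<Longrightarrow>
    norm (f (x, \<Gamma> \<epsilon> x) - f (x, \<gamma> x) - \<epsilon> *\<^sub>R dirder (0, \<gamma>\<^sub>1 x) f (x, \<gamma> x)) \<le> C * \<epsilon>\<^sup>2"
proof -
  obtain U where U: "U \<ge> 0" "\<And>x. norm (\<gamma>\<^sub>1 x) \<le> U" "\<And>x. norm (\<gamma>\<^sub>2 x) \<le> U"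
    "\<And>\<epsilon> x. 0 < \<epsilon> \<Longrightarrow> \<epsilon> \<le> 1 \<Longrightarrow> norm (\<gamma>\<^sub>1 x + \<epsilon> *\<^sub>R \<gamma>\<^sub>2 x) \<le> U" by (rule corrector_bound) (rule that)
  obtain B where B: "B \<ge> 0" "\<And>u v p. norm (dirder u (dirder v f) p) \<le> norm u * norm v * B"
    by (rule dirder2_bound[OF f_diff f_dirder_bounded_C]) (rule that)
  obtain L where L: "L > 0" "\<And>p v. norm (dirder v f p) \<le> L * norm v"
    by (rule bounded_C_dirder_Lipschitz[OF f_diff bounded_C_bounded[OF f_dirder_bounded_C]]) (rule that)
  have "norm (f (x, \<Gamma> \<epsilon> x) - f (x, \<gamma> x) - \<epsilon> *\<^sub>R dirder (0, \<gamma>\<^sub>1 x) f (x, \<gamma> x))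
      \<le> (DIM(real^'n) * (U * U * B) + L * U) * \<epsilon>\<^sup>2" if \<epsilon>: "0 < \<epsilon>" "\<epsilon> \<le> 1" for \<epsilon> x
  proof -
    let ?u = "(0 :: real^'n, \<gamma>\<^sub>1 x + \<epsilon> *\<^sub>R \<gamma>\<^sub>2 x)"
    have u: "norm ?u \<le> U" using U(4)[OF \<epsilon>] by (simp add: norm_Pair)
    have "norm (dirder ?u (dirder ?u f) p) \<le> U * U * B" for p
      using B(2)[of ?u ?u p] mult_right_mono[OF mult_mono[OF u u U(1) norm_ge_zero] B(1)] by linarith
    then have "norm (f ((x, \<gamma> x) + \<epsilon> *\<^sub>R ?u) - (f (x, \<gamma> x) + \<epsilon> *\<^sub>R dirder ?u f (x, \<gamma> x)))
        \<le> DIM(real^'n) * (U * U * B * \<epsilon>\<^sup>2)"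
      by (rule taylor_dirder_1[OF f_diff bounded_C_differentiable[OF f_dirder_bounded_C zero_less_one] _ \<epsilon>(1)])
    moreover have "(x, \<gamma> x) + \<epsilon> *\<^sub>R ?u = (x, \<Gamma> \<epsilon> x)" by (simp add: Gamma2_eq)
    moreover have "norm (\<epsilon>\<^sup>2 *\<^sub>R dirder (0, \<gamma>\<^sub>2 x) f (x, \<gamma> x)) \<le> \<epsilon>\<^sup>2 * (L * U)"
    proof -
      have "norm (dirder (0, \<gamma>\<^sub>2 x) f (x, \<gamma> x)) \<le> L * norm (0 :: real^'n, \<gamma>\<^sub>2 x)" by (rule L)
      also have "\<dots> \<le> L * U" using L(1) U(3)[of x] by (simp add: norm_Pair)
      finally show ?thesis by (simp add: mult_left_mono)
    qed
    moreover have "f (x, \<Gamma> \<epsilon> x) - f (x, \<gamma> x) - \<epsilon> *\<^sub>R dirder (0, \<gamma>\<^sub>1 x) f (x, \<gamma> x)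
      = (f (x, \<Gamma> \<epsilon> x) - (f (x, \<gamma> x) + \<epsilon> *\<^sub>R dirder ?u f (x, \<gamma> x))) + \<epsilon>\<^sup>2 *\<^sub>R dirder (0, \<gamma>\<^sub>2 x) f (x, \<gamma> x)"
      unfolding dirder_corrector[OF f_diff] by (simp add: algebra_simps power2_eq_square)
    ultimately have "norm (f (x, \<Gamma> \<epsilon> x) - f (x, \<gamma> x) - \<epsilon> *\<^sub>R dirder (0, \<gamma>\<^sub>1 x) f (x, \<gamma> x))
      \<le> DIM(real^'n) * (U * U * B * \<epsilon>\<^sup>2) + \<epsilon>\<^sup>2 * (L * U)"
      by (metis add_mono norm_triangle_le)
    then show ?thesis by (simp add: algebra_simps)
  qed
  then show ?thesis using that[of "DIM(real^'n) * (U * U * B) + L * U"] U(1) B(1) L(1) by simp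
qed

text \<open>One order more than for \<open>f\<close>, since \<open>g\<close> is not multiplied by
  \<epsilon> in the invariance equation. In the quadratic term the direction may be replaced by
  \<open>\<gamma>\<^sub>1\<close> at a cost of order \<epsilon>^3.\<close>

lemma g_expansion:
  obtains C where "C \<ge> 0" "\<And>\<epsilon> x. 0 < \<epsilon> \<Longrightarrow> \<epsilon> \<le> 1 \<Longrightarrow>
    norm (g (x, \<Gamma> \<epsilon> x) - (\<epsilon> *\<^sub>R dirder (0, \<gamma>\<^sub>1 x) g (x, \<gamma> x) + \<epsilon>\<^sup>2 *\<^sub>R (dirder (0, \<gamma>\<^sub>2 x) g (x, \<gamma> x)
      + (1/2) *\<^sub>R dirder (0, \<gamma>\<^sub>1 x) (dirder (0, \<gamma>\<^sub>1 x) g) (x, \<gamma> x)))) \<le> C * \<epsilon>^3"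
proof -
  obtain U where U: "U \<ge> 0" "\<And>x. norm (\<gamma>\<^sub>1 x) \<le> U" "\<And>x. norm (\<gamma>\<^sub>2 x) \<le> U"
    "\<And>\<epsilon> x. 0 < \<epsilon> \<Longrightarrow> \<epsilon> \<le> 1 \<Longrightarrow> norm (\<gamma>\<^sub>1 x + \<epsilon> *\<^sub>R \<gamma>\<^sub>2 x) \<le> U" by (rule corrector_bound) (rule that)
  obtain B3 where B3: "B3 \<ge> 0" "\<And>u v w p. norm (dirder u (dirder v (dirder w g)) p) \<le> norm u * norm v * norm w * B3"
    by (rule dirder3_bound[OF g_diff g_dirder_bounded_C]) (rule that)
  obtain B2 where B2: "B2 \<ge> 0" "\<And>u v p. norm (dirder u (dirder v g) p) \<le> norm u * norm v * B2"
    by (rule dirder2_bound[OF g_diff bounded_C_mono[OF g_dirder_bounded_C]]) (simp, rule that)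
  define K where "K = DIM(real^'m) * (U * U * U * B3) + U * U * B2"
  have "norm (g (x, \<Gamma> \<epsilon> x) - (\<epsilon> *\<^sub>R dirder (0, \<gamma>\<^sub>1 x) g (x, \<gamma> x) + \<epsilon>\<^sup>2 *\<^sub>R (dirder (0, \<gamma>\<^sub>2 x) g (x, \<gamma> x)
      + (1/2) *\<^sub>R dirder (0, \<gamma>\<^sub>1 x) (dirder (0, \<gamma>\<^sub>1 x) g) (x, \<gamma> x)))) \<le> K * \<epsilon>^3"
    if \<epsilon>: "0 < \<epsilon>" "\<epsilon> \<le> 1" for \<epsilon> x
  proof -
    let ?u = "(0 :: real^'n, \<gamma>\<^sub>1 x + \<epsilon> *\<^sub>R \<gamma>\<^sub>2 x)" and ?u1 = "(0 :: real^'n, \<gamma>\<^sub>1 x)"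
      and ?u2 = "(0 :: real^'n, \<gamma>\<^sub>2 x)" and ?p = "(x, \<gamma> x)"
    have u: "norm ?u \<le> U" "norm ?u1 \<le> U" "norm ?u2 \<le> U"
      using U(2-3)[of x] U(4)[OF \<epsilon>] by (simp_all add: norm_Pair)
    have "norm (dirder ?u (dirder ?u (dirder ?u g)) p) \<le> U * U * U * B3" for p
    proof -
      have "norm ?u * norm ?u * norm ?u * B3 \<le> U * U * U * B3"
        by (intro mult_mono u B3 mult_nonneg_nonneg U norm_ge_zero order_refl)
      then show ?thesis using B3(2)[of ?u ?u ?u p] by linarith
    qed
    then have "norm (g (?p + \<epsilon> *\<^sub>R ?u) - (g ?p + \<epsilon> *\<^sub>R dirder ?u g ?p + (\<epsilon>\<^sup>2 / 2) *\<^sub>R dirder ?u (dirder ?u g) ?p))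
        \<le> DIM(real^'m) * (U * U * U * B3 * \<epsilon>^3)"
      by (rule taylor_dirder_2[OF g_diff g_dirder_diff g_dirder2_diff _ \<epsilon>(1)])
    moreover have "?p + \<epsilon> *\<^sub>R ?u = (x, \<Gamma> \<epsilon> x)" by (simp add: Gamma2_eq)
    ultimately have T: "norm (g (x, \<Gamma> \<epsilon> x) - (\<epsilon> *\<^sub>R dirder ?u g ?p + (\<epsilon>\<^sup>2 / 2) *\<^sub>R dirder ?u (dirder ?u g) ?p))
        \<le> DIM(real^'m) * (U * U * U * B3 * \<epsilon>^3)" by (simp add: g_zero)
    \<comment> \<open>For a bilinear q and u = u1 + \<epsilon> u2, q(u,u) - q(u1,u1) = \<epsilon>
      (q(u,u2) + q(u2,u1)).\<close>
    have Q: "dirder ?u (dirder ?u g) ?p - dirder ?u1 (dirder ?u1 g) ?p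
      = \<epsilon> *\<^sub>R (dirder ?u (dirder ?u2 g) ?p + dirder ?u2 (dirder ?u1 g) ?p)"
    proof -
      have "dirder ?u g = (\<lambda>q. dirder ?u1 g q + \<epsilon> *\<^sub>R dirder ?u2 g q)"
        by (intro ext dirder_corrector g_diff)
      moreover have "((\<lambda>q. dirder ?u1 g q + \<epsilon> *\<^sub>R dirder ?u2 g q) has_derivative
        (\<lambda>v. dirder v (dirder ?u1 g) ?p + \<epsilon> *\<^sub>R dirder v (dirder ?u2 g) ?p)) (at ?p)"
        by (intro has_derivative_add has_derivative_scaleR_right has_derivative_dirder g_dirder_diff)
      ultimately have "dirder ?u (dirder ?u g) ?p = dirder ?u (dirder ?u1 g) ?p + \<epsilon> *\<^sub>R dirder ?u (dirder ?u2 g) ?p"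
        by (simp only: dirder_eq)
      also have "dirder ?u (dirder ?u1 g) ?p = dirder ?u1 (dirder ?u1 g) ?p + \<epsilon> *\<^sub>R dirder ?u2 (dirder ?u1 g) ?p"
        by (intro dirder_corrector g_dirder_diff)
      finally show ?thesis by (simp add: algebra_simps)
    qed
    have "norm (dirder ?u (dirder ?u2 g) ?p) \<le> U * U * B2" "norm (dirder ?u2 (dirder ?u1 g) ?p) \<le> U * U * B2"
      using B2(2)[of ?u ?u2 ?p] mult_right_mono[OF mult_mono[OF u(1,3) U(1) norm_ge_zero] B2(1)]
        B2(2)[of ?u2 ?u1 ?p] mult_right_mono[OF mult_mono[OF u(3,2) U(1) norm_ge_zero] B2(1)]
      by linarith+
    then have "norm (dirder ?u (dirder ?u2 g) ?p + dirder ?u2 (dirder ?u1 g) ?p) \<le> 2 * (U * U * B2)"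
      by (intro norm_triangle_le) linarith
    then have "norm ((\<epsilon>^3 / 2) *\<^sub>R (dirder ?u (dirder ?u2 g) ?p + dirder ?u2 (dirder ?u1 g) ?p)) \<le> (\<epsilon>^3 / 2) * (2 * (U * U * B2))"
      unfolding norm_scaleR using \<epsilon> by (intro mult_mono) auto
    then have E: "norm ((\<epsilon>^3 / 2) *\<^sub>R (dirder ?u (dirder ?u2 g) ?p + dirder ?u2 (dirder ?u1 g) ?p)) \<le> \<epsilon>^3 * (U * U * B2)"
      by simp
    have "g (x, \<Gamma> \<epsilon> x) - (\<epsilon> *\<^sub>R dirder ?u1 g ?p + \<epsilon>\<^sup>2 *\<^sub>R (dirder ?u2 g ?p + (1/2) *\<^sub>R dirder ?u1 (dirder ?u1 g) ?p))
      = (g (x, \<Gamma> \<epsilon> x) - (\<epsilon> *\<^sub>R dirder ?u g ?p + (\<epsilon>\<^sup>2 / 2) *\<^sub>R dirder ?u (dirder ?u g) ?p))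
        + (\<epsilon>\<^sup>2 / 2) *\<^sub>R (dirder ?u (dirder ?u g) ?p - dirder ?u1 (dirder ?u1 g) ?p)"
      unfolding dirder_corrector[OF g_diff] by (simp add: algebra_simps power2_eq_square)
    also have "\<dots> = (g (x, \<Gamma> \<epsilon> x) - (\<epsilon> *\<^sub>R dirder ?u g ?p + (\<epsilon>\<^sup>2 / 2) *\<^sub>R dirder ?u (dirder ?u g) ?p))
        + (\<epsilon>^3 / 2) *\<^sub>R (dirder ?u (dirder ?u2 g) ?p + dirder ?u2 (dirder ?u1 g) ?p)"
      unfolding Q by (simp add: power3_eq_cube power2_eq_square)
    also have "norm \<dots> \<le> DIM(real^'m) * (U * U * U * B3 * \<epsilon>^3) + \<epsilon>^3 * (U * U * B2)"
      by (rule norm_triangle_le) (rule add_mono[OF T E])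
    also have "\<dots> = K * \<epsilon>^3" by (simp add: K_def algebra_simps)
    finally show ?thesis .
  qed
  moreover have "K \<ge> 0" using U(1) B2(1) B3(1) by (simp add: K_def)
  ultimately show ?thesis by (rule that[rotated])
qed

text \<open>The two corrector equations cancel the terms of order \<epsilon> and \<epsilon>^2 of the
  defect by which the graph of \<open>\<Gamma>\<close> fails to be invariant; what remains is
  estimated piece by piece.\<close>

lemma invariance_residual:
  obtains C where "C \<ge> 0" "\<And>\<epsilon> x. 0 < \<epsilon> \<Longrightarrow> \<epsilon> \<le> 1 \<Longrightarrow>
    norm (g (x, \<Gamma> \<epsilon> x) - \<epsilon> *\<^sub>R d\<Gamma> \<epsilon> x (f (x, \<Gamma> \<epsilon> x))) \<le> C * \<epsilon>^3"
proof -
  obtain Cg where Cg: "Cg \<ge> 0" "\<And>\<epsilon> x. 0 < \<epsilon> \<Longrightarrow> \<epsilon> \<le> 1 \<Longrightarrow>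
    norm (g (x, \<Gamma> \<epsilon> x) - (\<epsilon> *\<^sub>R dirder (0, \<gamma>\<^sub>1 x) g (x, \<gamma> x) + \<epsilon>\<^sup>2 *\<^sub>R (dirder (0, \<gamma>\<^sub>2 x) g (x, \<gamma> x)
      + (1/2) *\<^sub>R dirder (0, \<gamma>\<^sub>1 x) (dirder (0, \<gamma>\<^sub>1 x) g) (x, \<gamma> x)))) \<le> Cg * \<epsilon>^3"
    by (rule g_expansion) (rule that)
  obtain Cf where Cf: "Cf \<ge> 0" "\<And>\<epsilon> x. 0 < \<epsilon> \<Longrightarrow> \<epsilon> \<le> 1 \<Longrightarrow>
    norm (f (x, \<Gamma> \<epsilon> x) - f (x, \<gamma> x) - \<epsilon> *\<^sub>R dirder (0, \<gamma>\<^sub>1 x) f (x, \<gamma> x)) \<le> Cf * \<epsilon>\<^sup>2"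
    by (rule f_expansion) (rule that)
  obtain L where L: "L > 0" "\<And>v x. norm (dirder v \<gamma> x) \<le> L * norm v"
    "\<And>v x. norm (dirder v \<gamma>\<^sub>1 x) \<le> L * norm v" "\<And>v x. norm (dirder v \<gamma>\<^sub>2 x) \<le> L * norm v"
    by (rule dirder_\<gamma>s_bound) (rule that)
  obtain M where M: "M \<ge> 0" "\<And>p. norm (f p) \<le> M"
    by (rule bounded_C_norm_le[OF f_bounded_C]) (rule that)
  obtain Lf where Lf: "Lf > 0" "\<And>p q. norm (f p - f q) \<le> Lf * norm (p - q)"
    by (rule f_Lipschitz) (rule that)
  obtain U where U: "U \<ge> 0" "\<And>\<epsilon> x. 0 < \<epsilon> \<Longrightarrow> \<epsilon> \<le> 1 \<Longrightarrow> norm (\<gamma>\<^sub>1 x + \<epsilon> *\<^sub>R \<gamma>\<^sub>2 x) \<le> U"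
    by (rule corrector_bound) (rule that)
  define K where "K = Cg + L * Cf + L * (Lf * U) + L * M"
  have "norm (g (x, \<Gamma> \<epsilon> x) - \<epsilon> *\<^sub>R d\<Gamma> \<epsilon> x (f (x, \<Gamma> \<epsilon> x))) \<le> K * \<epsilon>^3"
    if \<epsilon>: "0 < \<epsilon>" "\<epsilon> \<le> 1" for \<epsilon> x
  proof -
    let ?F = "f (x, \<gamma> x)" and ?f = "f (x, \<Gamma> \<epsilon> x)" and ?F1 = "dirder (0, \<gamma>\<^sub>1 x) f (x, \<gamma> x)"
    define E where "E = g (x, \<Gamma> \<epsilon> x) - (\<epsilon> *\<^sub>R dirder (0, \<gamma>\<^sub>1 x) g (x, \<gamma> x) + \<epsilon>\<^sup>2 *\<^sub>R (dirder (0, \<gamma>\<^sub>2 x) g (x, \<gamma> x)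
      + (1/2) *\<^sub>R dirder (0, \<gamma>\<^sub>1 x) (dirder (0, \<gamma>\<^sub>1 x) g) (x, \<gamma> x)))"
    \<comment> \<open>\<open>A\<close>, \<open>B\<close> and \<open>D\<close> are what is left of
      the three terms of \<epsilon> D\<Gamma> f once their parts up to order \<epsilon>^2 are
      removed. The differences of values of \<open>f\<close> are of order \<epsilon>^2 in
      \<open>A\<close> and \<epsilon> in \<open>B\<close>, so each piece is of order
      \<epsilon>^3.\<close>
    define A where "A = \<epsilon> *\<^sub>R dirder (?f - ?F - \<epsilon> *\<^sub>R ?F1) \<gamma> x"
    define B where "B = \<epsilon>\<^sup>2 *\<^sub>R dirder (?f - ?F) \<gamma>\<^sub>1 x"
    define D where "D = \<epsilon>^3 *\<^sub>R dirder ?f \<gamma>\<^sub>2 x"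
    have A': "A = \<epsilon> *\<^sub>R dirder ?f \<gamma> x - \<epsilon> *\<^sub>R dirder ?F \<gamma> x - \<epsilon>\<^sup>2 *\<^sub>R dirder ?F1 \<gamma> x"
      unfolding A_def linear_diff[OF linear_dirder[OF \<gamma>_diff]] linear_cmul[OF linear_dirder[OF \<gamma>_diff]]
      by (simp add: algebra_simps power2_eq_square)
    have B': "B = \<epsilon>\<^sup>2 *\<^sub>R dirder ?f \<gamma>\<^sub>1 x - \<epsilon>\<^sup>2 *\<^sub>R dirder ?F \<gamma>\<^sub>1 x"
      unfolding B_def linear_diff[OF linear_dirder[OF gamma1_diff]] by (simp add: algebra_simps)
    \<comment> \<open>The cancellation: \<open>gamma1_eq\<close> and \<open>gamma2_eq\<close> match
      the low-order part subtracted in \<open>E\<close> with those subtracted in \<open>A\<close>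
      and \<open>B\<close>.\<close>
    have eq: "g (x, \<Gamma> \<epsilon> x) - \<epsilon> *\<^sub>R d\<Gamma> \<epsilon> x ?f = E - A - B - D"
      unfolding A' B' D_def E_def d\<Gamma>_def gamma1_eq gamma2_eq
      by (simp add: algebra_simps power2_eq_square power3_eq_cube)
    have nE: "norm E \<le> Cg * \<epsilon>^3" unfolding E_def by (rule Cg(2)[OF \<epsilon>])
    have nA: "norm A \<le> L * Cf * \<epsilon>^3"
    proof -
      have "norm A \<le> \<epsilon> * (L * (Cf * \<epsilon>\<^sup>2))"
        unfolding A_def norm_scaleR using \<epsilon> L
        by (intro mult_mono order_trans[OF L(2)] Cf(2)) auto
      then show ?thesis by (simp add: power3_eq_cube power2_eq_square mult_ac)
    qed
    have nB: "norm B \<le> L * (Lf * U) * \<epsilon>^3"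
    proof -
      have "norm (?f - ?F) \<le> Lf * norm ((x, \<Gamma> \<epsilon> x) - (x, \<gamma> x))" by (rule Lf)
      also have "\<dots> = Lf * (\<epsilon> * norm (\<gamma>\<^sub>1 x + \<epsilon> *\<^sub>R \<gamma>\<^sub>2 x))"
        using \<epsilon> by (simp add: Gamma2_eq norm_Pair)
      also have "\<dots> \<le> Lf * (\<epsilon> * U)" using Lf \<epsilon> U by (intro mult_left_mono) auto
      finally have "norm B \<le> \<epsilon>\<^sup>2 * (L * (Lf * (\<epsilon> * U)))"
        unfolding B_def norm_scaleR using L \<epsilon>
        by (intro mult_mono order_trans[OF L(3)]) auto
      then show ?thesis by (simp add: power3_eq_cube power2_eq_square mult_ac)
    qed
    have nD: "norm D \<le> L * M * \<epsilon>^3"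
    proof -
      have "norm D \<le> \<epsilon>^3 * (L * M)"
        unfolding D_def norm_scaleR using L \<epsilon> M
        by (intro mult_mono order_trans[OF L(4)]) auto
      then show ?thesis by (simp add: mult_ac)
    qed
    have "norm (E - A - B - D) \<le> norm E + norm A + norm B + norm D" by norm
    then show ?thesis unfolding eq K_def using nE nA nB nD by (simp add: algebra_simps)
  qed
  moreover have "K \<ge> 0" using Cg(1) Cf(1) L(1) Lf(1) U(1) M(1) by (simp add: K_def)
  ultimately show ?thesis by (rule that[rotated])
qed

end

subsection \<open>Differential inequalities\<close>

text \<open>The product with the integrating factor exp(-C s) is nonincreasing. Derivatives are
  taken within {0..} because solutions live on that half-line.\<close>

lemma gronwall_exp:
  fixes \<Psi> \<Psi>' :: "real \<Rightarrow> real"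
  assumes D: "\<And>t. t \<ge> 0 \<Longrightarrow> (\<Psi> has_real_derivative \<Psi>' t) (at t within {0..})"
    and le: "\<And>t. t \<ge> 0 \<Longrightarrow> \<Psi>' t \<le> C * \<Psi> t" and t: "t \<ge> 0"
  shows "\<Psi> t \<le> exp (C * t) * \<Psi> 0"
proof -
  define h where "h s = \<Psi> s * exp (- (C * s))" for s
  have h: "(h has_real_derivative (\<Psi>' s - C * \<Psi> s) * exp (- (C * s))) (at s within {0..})" if "s \<ge> 0" for s
    unfolding h_def using D[OF that] by (auto intro!: derivative_eq_intros simp: algebra_simps)
  have "h 0 \<ge> h t"
  proof (rule DERIV_nonpos_imp_decreasing_open[OF t])
    fix s :: real assume s: "0 < s" "s < t"
    \<comment> \<open>At interior points the derivative is two-sided; at the endpoint 0 the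
      monotonicity criterion asks for continuity only.\<close>
    have "at s within {0..} = at s" using s by (intro at_within_interior) auto
    then have "(h has_real_derivative (\<Psi>' s - C * \<Psi> s) * exp (- (C * s))) (at s)"
      using h[of s] s by simp
    moreover have "(\<Psi>' s - C * \<Psi> s) * exp (- (C * s)) \<le> 0"
      using le[of s] s by (intro mult_nonpos_nonneg) auto
    ultimately show "\<exists>y. (h has_real_derivative y) (at s) \<and> y \<le> 0" by blast
  next
    have "continuous_on {0..} h"
      using h by (auto simp: continuous_on_eq_continuous_within intro: DERIV_continuous)
    then show "continuous_on {0..t} h" by (rule continuous_on_subset) auto
  qed
  then have "\<Psi> t * exp (- (C * t)) * exp (C * t) \<le> \<Psi> 0 * exp (C * t)"
    unfolding h_def by (intro mult_right_mono) auto
  then show ?thesis by (simp add: mult.assoc exp_minus mult.commute[of "\<Psi> 0"])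
qed

lemma has_real_derivative_norm_power2:
  fixes w :: "real \<Rightarrow> 'a::real_inner"
  assumes "(w has_vector_derivative w') (at t within S)"
  shows "((\<lambda>t. (norm (w t))\<^sup>2) has_real_derivative 2 * (w' \<bullet> w t)) (at t within S)"
  using bounded_bilinear.has_vector_derivative[OF bounded_bilinear_inner assms assms]
  by (simp add: power2_norm_eq_inner has_real_derivative_iff_has_vector_derivative inner_commute)

text \<open>Here W and Z stand for |w| and |z|, and wd, zd for the inner products of w', z' with w,
  z. After weighting, the decay is 2 Z^2, while the slow feedback, the forcing and the coupling each
  consume at most Z^2/2.\<close>

lemma lyapunov_inequality:
  fixes W Z wd zd L G C \<beta> \<epsilon> :: real
  assumes pos: "L > 0" "G > 0" "\<beta> > 0" "\<epsilon> > 0" and small: "\<epsilon> \<le> \<beta> / (4 * G * L)"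
    and w: "wd \<le> L * (1 + G) * W\<^sup>2 + L * Z * W"
    and z: "zd \<le> - (\<beta> / \<epsilon>) * Z\<^sup>2 + C * \<epsilon>\<^sup>2 * Z + G * L * Z\<^sup>2"
  shows "2 * wd + (\<epsilon> / \<beta>) * (2 * zd) \<le> (2 * L * (1 + G) + 2 * L\<^sup>2) * W\<^sup>2 + 2 * (C / \<beta>)\<^sup>2 * \<epsilon>^6"
proof -
  \<comment> \<open>From (b - 2a)^2 >= 0, with weights chosen so that the factor Z receives only
    1/2.\<close>
  have young: "2 * (a * b) \<le> b\<^sup>2 / 2 + 2 * a\<^sup>2" for a b :: real
    using zero_le_power2[of "b - 2 * a"] by (simp add: power2_diff power_mult_distrib mult.commute)
  have "(\<epsilon> / \<beta>) * zd \<le> (\<epsilon> / \<beta>) * (- (\<beta> / \<epsilon>) * Z\<^sup>2 + C * \<epsilon>\<^sup>2 * Z + G * L * Z\<^sup>2)"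
    using z pos by (intro mult_left_mono) auto
  also have "\<dots> = - Z\<^sup>2 + (C / \<beta> * \<epsilon>^3) * Z + (\<epsilon> * (G * L) / \<beta>) * Z\<^sup>2"
    using pos by (simp add: field_simps power2_eq_square power3_eq_cube)
  \<comment> \<open>This is where the smallness threshold \<beta>/(4GL) originates.\<close>
  also have "(\<epsilon> * (G * L) / \<beta>) * Z\<^sup>2 \<le> 1/4 * Z\<^sup>2"
    using small pos by (intro mult_right_mono) (auto simp: field_simps)
  finally have 1: "(\<epsilon> / \<beta>) * zd \<le> - (3/4) * Z\<^sup>2 + (C / \<beta> * \<epsilon>^3) * Z" by simp
  have 2: "2 * ((C / \<beta> * \<epsilon>^3) * Z) \<le> Z\<^sup>2 / 2 + 2 * (C / \<beta> * \<epsilon>^3)\<^sup>2"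
    by (rule young)
  have 3: "2 * (L * Z * W) \<le> Z\<^sup>2 / 2 + 2 * L\<^sup>2 * W\<^sup>2"
    using young[of "L * W" Z] by (simp add: power_mult_distrib mult_ac)
  have 4: "(C / \<beta> * \<epsilon>^3)\<^sup>2 = (C / \<beta>)\<^sup>2 * \<epsilon>^6"
    unfolding power_mult_distrib power_mult[symmetric] by simp
  have "2 * wd + 2 * ((\<epsilon> / \<beta>) * zd) \<le> 2 * (L * (1 + G) * W\<^sup>2) + 2 * L\<^sup>2 * W\<^sup>2 + 2 * ((C / \<beta>)\<^sup>2 * \<epsilon>^6)"
    using 1 2 3 w zero_le_power2[of Z] unfolding 4 by linarith
  then show ?thesis by (simp add: algebra_simps)
qed

section \<open>The energy estimate for the slow-fast and the reduced solutions\<close>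

context slow_fast
begin

lemma Gamma2_comp_has_vector_derivative:
  assumes "(x has_vector_derivative x') (at t within S)"
  shows "((\<lambda>t. \<Gamma> \<epsilon> (x t)) has_vector_derivative d\<Gamma> \<epsilon> (x t) x') (at t within S)"
proof -
  have "((\<lambda>t. \<Gamma> \<epsilon> (x t)) has_derivative (\<lambda>h. d\<Gamma> \<epsilon> (x t) (h *\<^sub>R x'))) (at t within S)"
    using has_derivative_compose[OF assms[unfolded has_vector_derivative_def] Gamma2_has_derivative] .
  then show ?thesis
    unfolding has_vector_derivative_def
      linear_cmul[OF has_derivative_linear[OF Gamma2_has_derivative]] .
qed

lemma slow_fast_estimate:
  assumes "\<epsilon>0 > 0"
  obtains C \<epsilon>1 where "C > 0" "0 < \<epsilon>1" "\<epsilon>1 \<le> \<epsilon>0"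
    "\<And>\<epsilon> x y X t. 0 < \<epsilon> \<Longrightarrow> \<epsilon> \<le> \<epsilon>1 \<Longrightarrow> solves_slow_fast f g \<epsilon> x y \<Longrightarrow> solves_reduced f g \<gamma> \<epsilon> X \<Longrightarrow>
      t \<ge> 0 \<Longrightarrow> (norm (x t - X t))\<^sup>2 \<le> exp (C * t) *
        ((norm (x 0 - X 0))\<^sup>2 + \<epsilon>^6 + \<epsilon> / \<beta> * (norm (y 0 - \<Gamma> \<epsilon> (x 0)))\<^sup>2)"
proof -
  obtain L where L: "L > 0" "\<And>p q. norm (f p - f q) \<le> L * norm (p - q)"
    by (rule f_Lipschitz) (rule that)
  obtain G1 where G1: "G1 > 0" "\<And>\<epsilon> x x'. 0 < \<epsilon> \<Longrightarrow> \<epsilon> \<le> 1 \<Longrightarrow> norm (\<Gamma> \<epsilon> x - \<Gamma> \<epsilon> x') \<le> G1 * norm (x - x')"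
    by (rule Gamma2_Lipschitz) (rule that)
  obtain G2 where G2: "G2 > 0" "\<And>\<epsilon> v x. 0 < \<epsilon> \<Longrightarrow> \<epsilon> \<le> 1 \<Longrightarrow> norm (d\<Gamma> \<epsilon> x v) \<le> G2 * norm v"
    by (rule d\<Gamma>_bound) (rule that)
  obtain R where R: "R \<ge> 0" "\<And>\<epsilon> x. 0 < \<epsilon> \<Longrightarrow> \<epsilon> \<le> 1 \<Longrightarrow>
    norm (g (x, \<Gamma> \<epsilon> x) - \<epsilon> *\<^sub>R d\<Gamma> \<epsilon> x (f (x, \<Gamma> \<epsilon> x))) \<le> R * \<epsilon>^3"
    by (rule invariance_residual) (rule that)
  \<comment> \<open>One constant for both roles: Lipschitz constant of \<open>\<Gamma>\<close> and
    bound on its derivative.\<close>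
  define G where "G = G1 + G2"
  have G: "G > 0" using G1(1) G2(1) by (simp add: G_def)
  \<comment> \<open>The sum of the coefficients of |w|^2 and \<epsilon>^6 in
    \<open>lyapunov_inequality\<close>, so that it dominates each of them.\<close>
  define C where "C = (2 * L * (1 + G) + 2 * L\<^sup>2) + 2 * (R / \<beta>)\<^sup>2"
  have C: "C > 0" unfolding C_def using L(1) G by (intro add_pos_nonneg) auto
  \<comment> \<open>The bound 1 makes the estimates on \<open>\<Gamma>\<close> uniform in
    \<epsilon>; the last bound is the absorption threshold.\<close>
  define \<epsilon>1 where "\<epsilon>1 = min \<epsilon>0 (min 1 (\<beta> / (4 * G * L)))"
  have "0 < \<epsilon>1" "\<epsilon>1 \<le> \<epsilon>0" using assms L(1) G \<beta>_pos by (auto simp: \<epsilon>1_def)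
  moreover have "(norm (x t - X t))\<^sup>2 \<le> exp (C * t) *
        ((norm (x 0 - X 0))\<^sup>2 + \<epsilon>^6 + \<epsilon> / \<beta> * (norm (y 0 - \<Gamma> \<epsilon> (x 0)))\<^sup>2)"
    if \<epsilon>: "0 < \<epsilon>" "\<epsilon> \<le> \<epsilon>1" and sol: "solves_slow_fast f g \<epsilon> x y" and red: "solves_reduced f g \<gamma> \<epsilon> X"
      and t: "t \<ge> 0" for \<epsilon> x y X t
  proof -
    have \<epsilon>1: "\<epsilon> \<le> 1" and small: "\<epsilon> \<le> \<beta> / (4 * G * L)" using \<epsilon> by (auto simp: \<epsilon>1_def)
    define w where "w t = x t - X t" for t
    define z where "z t = y t - \<Gamma> \<epsilon> (x t)" for t
    define w' where "w' t = f (x t, y t) - f (X t, \<Gamma> \<epsilon> (X t))" for t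
    define z' where "z' t = (1 / \<epsilon>) *\<^sub>R g (x t, y t) - d\<Gamma> \<epsilon> (x t) (f (x t, y t))" for t
    define \<Psi> where "\<Psi> t = (norm (w t))\<^sup>2 + \<epsilon>^6 + \<epsilon> / \<beta> * (norm (z t))\<^sup>2" for t
    define \<Psi>' where "\<Psi>' t = 2 * (w' t \<bullet> w t) + (\<epsilon> / \<beta>) * (2 * (z' t \<bullet> z t))" for t
    have w: "(w has_vector_derivative w' s) (at s within {0..})" if "s \<ge> 0" for s
      unfolding w_def w'_def
      using sol red that unfolding solves_slow_fast_def solves_reduced_def
      by (intro has_vector_derivative_diff) auto
    have z: "(z has_vector_derivative z' s) (at s within {0..})" if "s \<ge> 0" for s
      unfolding z_def z'_def
      using sol that unfolding solves_slow_fast_def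
      by (intro has_vector_derivative_diff Gamma2_comp_has_vector_derivative) auto
    have D: "(\<Psi> has_real_derivative \<Psi>' s) (at s within {0..})" if "s \<ge> 0" for s
    proof -
      have "(\<Psi> has_real_derivative (2 * (w' s \<bullet> w s) + 0 + (\<epsilon> / \<beta>) * (2 * (z' s \<bullet> z s)))) (at s within {0..})"
        unfolding \<Psi>_def
        by (intro DERIV_add DERIV_const DERIV_cmult has_real_derivative_norm_power2 w z that)
      then show ?thesis by (simp add: \<Psi>'_def)
    qed
    have le: "\<Psi>' s \<le> C * \<Psi> s" if "s \<ge> 0" for s
    proof -
      have "norm (w' s) \<le> L * ((1 + G) * norm (w s) + norm (z s))"
      proof -
        have "norm (w' s) \<le> L * norm ((x s, y s) - (X s, \<Gamma> \<epsilon> (X s)))" unfolding w'_def by (rule L)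
        also have "norm ((x s, y s) - (X s, \<Gamma> \<epsilon> (X s))) \<le> norm (w s) + norm (y s - \<Gamma> \<epsilon> (X s))"
          using norm_Pair_le[of "x s - X s" "y s - \<Gamma> \<epsilon> (X s)"] by (simp add: w_def)
        \<comment> \<open>Passing through \<Gamma>(x) separates the distance to the manifold from
          the displacement along it.\<close>
        also have "norm (y s - \<Gamma> \<epsilon> (X s)) \<le> norm (z s) + norm (\<Gamma> \<epsilon> (x s) - \<Gamma> \<epsilon> (X s))"
          using norm_triangle_ineq[of "z s" "\<Gamma> \<epsilon> (x s) - \<Gamma> \<epsilon> (X s)"] by (simp add: z_def)
        also have "norm (\<Gamma> \<epsilon> (x s) - \<Gamma> \<epsilon> (X s)) \<le> G * norm (w s)"
          unfolding w_def using G2(1)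
          by (intro order_trans[OF G1(2)[OF \<epsilon>(1) \<epsilon>1]] mult_right_mono) (auto simp: G_def)
        finally show ?thesis using L(1) by (simp add: algebra_simps)
      qed
      then have "norm (w' s) * norm (w s) \<le> L * ((1 + G) * norm (w s) + norm (z s)) * norm (w s)"
        by (rule mult_right_mono) simp
      then have wd: "w' s \<bullet> w s \<le> L * (1 + G) * (norm (w s))\<^sup>2 + L * norm (z s) * norm (w s)"
        using norm_cauchy_schwarz[of "w' s" "w s"] by (simp add: algebra_simps power2_eq_square)
      have zd: "z' s \<bullet> z s \<le> - (\<beta> / \<epsilon>) * (norm (z s))\<^sup>2 + R * \<epsilon>\<^sup>2 * norm (z s) + G * L * (norm (z s))\<^sup>2"
      proof -
        let ?g = "g (x s, \<Gamma> \<epsilon> (x s))" and ?f = "f (x s, \<Gamma> \<epsilon> (x s))"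
        have lin: "linear (d\<Gamma> \<epsilon> (x s))" by (rule has_derivative_linear[OF Gamma2_has_derivative])
        \<comment> \<open>Three effects are separated: contraction by monotonicity, the invariance
          residual, and the error in the slow velocity when y is replaced by \<Gamma>(x).\<close>
        have "z' s = (1 / \<epsilon>) *\<^sub>R (g (x s, y s) - ?g) + (1 / \<epsilon>) *\<^sub>R (?g - \<epsilon> *\<^sub>R d\<Gamma> \<epsilon> (x s) ?f)
            + d\<Gamma> \<epsilon> (x s) (?f - f (x s, y s))"
          unfolding z'_def linear_diff[OF lin] using \<epsilon>(1) by (simp add: algebra_simps)
        then have "z' s \<bullet> z s = (1 / \<epsilon>) * ((g (x s, y s) - ?g) \<bullet> z s)
            + (1 / \<epsilon>) * ((?g - \<epsilon> *\<^sub>R d\<Gamma> \<epsilon> (x s) ?f) \<bullet> z s) + d\<Gamma> \<epsilon> (x s) (?f - f (x s, y s)) \<bullet> z s"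
          by (simp only: inner_add_left inner_scaleR_left)
        moreover have "(1 / \<epsilon>) * ((g (x s, y s) - ?g) \<bullet> z s) \<le> (1 / \<epsilon>) * (- \<beta> * (norm (z s))\<^sup>2)"
          using monotone[of "x s" "y s" "\<Gamma> \<epsilon> (x s)"] \<epsilon>(1) unfolding z_def[symmetric]
          by (intro mult_left_mono) auto
        moreover have "(1 / \<epsilon>) * ((?g - \<epsilon> *\<^sub>R d\<Gamma> \<epsilon> (x s) ?f) \<bullet> z s) \<le> (1 / \<epsilon>) * (R * \<epsilon>^3 * norm (z s))"
          using \<epsilon>(1) R(2)[OF \<epsilon>(1) \<epsilon>1, of "x s"]
          by (intro mult_left_mono order_trans[OF norm_cauchy_schwarz] mult_right_mono) auto
        moreover have "d\<Gamma> \<epsilon> (x s) (?f - f (x s, y s)) \<bullet> z s \<le> G * L * norm (z s) * norm (z s)"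
        proof -
          have "norm (?f - f (x s, y s)) \<le> L * norm ((x s, \<Gamma> \<epsilon> (x s)) - (x s, y s))" by (rule L)
          also have "\<dots> = L * norm (z s)" by (simp add: norm_Pair z_def norm_minus_commute)
          finally have "G2 * norm (?f - f (x s, y s)) \<le> G * (L * norm (z s))"
            using G1(1) G2(1) by (intro mult_mono) (auto simp: G_def)
          then have "norm (d\<Gamma> \<epsilon> (x s) (?f - f (x s, y s))) \<le> G * (L * norm (z s))"
            using G2(2)[OF \<epsilon>(1) \<epsilon>1] by (rule order_trans[rotated])
          then show ?thesis
            by (intro order_trans[OF norm_cauchy_schwarz] mult_right_mono) (auto simp: mult.assoc)
        qed
        ultimately show ?thesis
          using \<epsilon>(1) by (simp add: power2_eq_square power3_eq_cube algebra_simps)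
      qed
      have "\<Psi>' s \<le> (2 * L * (1 + G) + 2 * L\<^sup>2) * (norm (w s))\<^sup>2 + 2 * (R / \<beta>)\<^sup>2 * \<epsilon>^6"
        unfolding \<Psi>'_def by (rule lyapunov_inequality[OF L(1) G \<beta>_pos \<epsilon>(1) small wd zd])
      also have "\<dots> \<le> C * (norm (w s))\<^sup>2 + C * \<epsilon>^6"
        using L(1) G \<epsilon>(1) by (intro add_mono mult_right_mono) (auto simp: C_def)
      also have "\<dots> \<le> C * \<Psi> s"
        using C \<epsilon>(1) \<beta>_pos by (simp add: \<Psi>_def algebra_simps)
      finally show ?thesis .
    qed
    have "(norm (w t))\<^sup>2 \<le> \<Psi> t" using \<epsilon>(1) \<beta>_pos by (simp add: \<Psi>_def)
    also have "\<dots> \<le> exp (C * t) * \<Psi> 0" by (rule gronwall_exp[OF D le t])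
    finally show ?thesis by (simp add: \<Psi>_def w_def z_def)
  qed
  ultimately show ?thesis using that C by blast
qed

end

text \<open>The exponent 5/2 is the one for which \<epsilon> |z(0)|^2 has the order \<epsilon>^6 of
  the other two terms; taking the square root gives \<epsilon>^3.\<close>

lemma order_three_bound:
  fixes C T a b \<beta> \<epsilon> t u v d :: real
  assumes pos: "C > 0" "\<beta> > 0" "\<epsilon> > 0" and t: "t \<in> {0..T}"
    and u: "0 \<le> u" "u \<le> a * \<epsilon>^3" and v: "0 \<le> v" "v \<le> b * \<epsilon> powr (5/2)"
    and d: "d\<^sup>2 \<le> exp (C * t) * (u\<^sup>2 + \<epsilon>^6 + \<epsilon> / \<beta> * v\<^sup>2)"
  shows "d \<le> sqrt (exp (C * T) * (a\<^sup>2 + 1 + b\<^sup>2 / \<beta>)) * \<epsilon>^3"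
proof -
  have "u\<^sup>2 \<le> (a * \<epsilon>^3)\<^sup>2" using u by (intro power_mono) auto
  then have u2: "u\<^sup>2 \<le> a\<^sup>2 * \<epsilon>^6" by (simp add: power_mult_distrib flip: power_mult)
  have "(\<epsilon> powr (5/2))\<^sup>2 = \<epsilon> powr 5" by (simp add: power2_eq_square flip: powr_add)
  also have "\<dots> = \<epsilon>^5" using pos by (simp add: powr_numeral)
  finally have p: "(\<epsilon> powr (5/2))\<^sup>2 = \<epsilon>^5" .
  have "v\<^sup>2 \<le> (b * \<epsilon> powr (5/2))\<^sup>2" using v by (intro power_mono) auto
  then have "v\<^sup>2 \<le> b\<^sup>2 * \<epsilon>^5" by (simp add: power_mult_distrib p)
  then have "\<epsilon> / \<beta> * v\<^sup>2 \<le> \<epsilon> / \<beta> * (b\<^sup>2 * \<epsilon>^5)" using pos by (intro mult_left_mono) auto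
  also have "\<dots> = b\<^sup>2 / \<beta> * \<epsilon>^6" by (simp add: power_numeral_reduce)
  finally have "u\<^sup>2 + \<epsilon>^6 + \<epsilon> / \<beta> * v\<^sup>2 \<le> (a\<^sup>2 + 1 + b\<^sup>2 / \<beta>) * \<epsilon>^6"
    using u2 by (simp add: algebra_simps)
  then have "exp (C * t) * (u\<^sup>2 + \<epsilon>^6 + \<epsilon> / \<beta> * v\<^sup>2) \<le> exp (C * T) * ((a\<^sup>2 + 1 + b\<^sup>2 / \<beta>) * \<epsilon>^6)"
    using pos t by (intro mult_mono) auto
  with d have "d\<^sup>2 \<le> exp (C * T) * (a\<^sup>2 + 1 + b\<^sup>2 / \<beta>) * (\<epsilon>^3)\<^sup>2"
    by (simp add: mult.assoc flip: power_mult)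
  then have "d \<le> sqrt (exp (C * T) * (a\<^sup>2 + 1 + b\<^sup>2 / \<beta>) * (\<epsilon>^3)\<^sup>2)" by (rule real_le_rsqrt)
  then show ?thesis
    using pos unfolding real_sqrt_mult[of _ "(\<epsilon>^3)\<^sup>2"] real_sqrt_abs by simp
qed

theorem theorem3p5:
  fixes f :: "(real^'n::finite) \<times> (real^'m::finite) \<Rightarrow> real^'n"
    and g :: "(real^'n) \<times> (real^'m) \<Rightarrow> real^'m"
    and \<gamma> :: "real^'n \<Rightarrow> real^'m"
    and \<beta> \<epsilon>0 :: real
    and K :: nat
  assumes "K \<ge> 2"
    and "C_k K f" and "W_norm K f < \<infinity>"
    and "C_k (Suc K) g" and "W_norm_nabla K g < \<infinity>"
    and "\<And>x. g (x, \<gamma> x) = 0"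
    and "\<beta> > 0"
    and "\<And>x y y'. (g (x, y) - g (x, y')) \<bullet> (y - y') \<le> - \<beta> * (norm (y - y'))\<^sup>2"
    and "\<epsilon>0 > 0"
  shows
    "(\<exists>C>0. \<exists>\<epsilon>1\<in>{0<..\<epsilon>0}. \<forall>\<epsilon>\<in>{0<..\<epsilon>1}. \<forall>x y X.
        solves_slow_fast f g \<epsilon> x y \<longrightarrow> solves_reduced f g \<gamma> \<epsilon> X \<longrightarrow>
        (\<forall>t\<ge>0. (norm (x t - X t))\<^sup>2 \<le> exp (C * t) *
           ((norm (x 0 - X 0))\<^sup>2 + \<epsilon> ^ 6
            + \<epsilon> / \<beta> * (norm (y 0 - Gamma2 f g \<gamma> (x 0) \<epsilon>))\<^sup>2)))
     \<and>
     (\<forall>x y X.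
        (\<forall>\<^sub>F \<epsilon> in at_right 0.
            solves_slow_fast f g \<epsilon> (x \<epsilon>) (y \<epsilon>) \<and> solves_reduced f g \<gamma> \<epsilon> (X \<epsilon>)) \<longrightarrow>
        (\<lambda>\<epsilon>. norm (x \<epsilon> 0 - X \<epsilon> 0)) \<in> O[at_right 0](\<lambda>\<epsilon>. \<epsilon> ^ 3) \<longrightarrow>
        (\<lambda>\<epsilon>. norm (y \<epsilon> 0 - Gamma2 f g \<gamma> (x \<epsilon> 0) \<epsilon>)) \<in> O[at_right 0](\<lambda>\<epsilon>. \<epsilon> powr (5/2)) \<longrightarrow>
        (\<forall>T>0. \<exists>M. \<forall>\<^sub>F \<epsilon> in at_right 0. \<forall>t\<in>{0..T}. norm (x \<epsilon> t - X \<epsilon> t) \<le> M * \<epsilon> ^ 3))"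
proof -
  interpret slow_fast f g \<gamma> \<beta>
  proof
    show "bounded_C 2 f" by (rule bounded_C_mono[OF W_norm_bounded_C]) fact+
    show "g differentiable (at p)" for p using assms(4) unfolding C_k_Suc_dirder by blast
    show "bounded_C 2 (dirder b g)" if "b \<in> Basis" for b
      by (rule bounded_C_mono[OF W_norm_nabla_bounded_C]) fact+
  qed fact+
  obtain C \<epsilon>1 where C: "C > 0" "0 < \<epsilon>1" "\<epsilon>1 \<le> \<epsilon>0"
    and est: "\<And>\<epsilon> x y X t. 0 < \<epsilon> \<Longrightarrow> \<epsilon> \<le> \<epsilon>1 \<Longrightarrow> solves_slow_fast f g \<epsilon> x y \<Longrightarrow> solves_reduced f g \<gamma> \<epsilon> X \<Longrightarrow>
      t \<ge> 0 \<Longrightarrow> (norm (x t - X t))\<^sup>2 \<le> exp (C * t) *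
        ((norm (x 0 - X 0))\<^sup>2 + \<epsilon>^6 + \<epsilon> / \<beta> * (norm (y 0 - Gamma2 f g \<gamma> (x 0) \<epsilon>))\<^sup>2)"
    by (rule slow_fast_estimate[OF \<open>\<epsilon>0 > 0\<close>]) (rule that)
  show ?thesis
  proof (intro conjI allI impI)
    show "\<exists>C>0. \<exists>\<epsilon>1\<in>{0<..\<epsilon>0}. \<forall>\<epsilon>\<in>{0<..\<epsilon>1}. \<forall>x y X.
        solves_slow_fast f g \<epsilon> x y \<longrightarrow> solves_reduced f g \<gamma> \<epsilon> X \<longrightarrow>
        (\<forall>t\<ge>0. (norm (x t - X t))\<^sup>2 \<le> exp (C * t) *
           ((norm (x 0 - X 0))\<^sup>2 + \<epsilon> ^ 6
            + \<epsilon> / \<beta> * (norm (y 0 - Gamma2 f g \<gamma> (x 0) \<epsilon>))\<^sup>2))"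
      using C est by (intro exI[of _ C] conjI bexI[of _ \<epsilon>1] ballI allI impI) auto
  next
    fix x y X and T :: real
    assume sol: "\<forall>\<^sub>F \<epsilon> in at_right 0.
        solves_slow_fast f g \<epsilon> (x \<epsilon>) (y \<epsilon>) \<and> solves_reduced f g \<gamma> \<epsilon> (X \<epsilon>)"
      and w0: "(\<lambda>\<epsilon>. norm (x \<epsilon> 0 - X \<epsilon> 0)) \<in> O[at_right 0](\<lambda>\<epsilon>. \<epsilon> ^ 3)"
      and z0: "(\<lambda>\<epsilon>. norm (y \<epsilon> 0 - Gamma2 f g \<gamma> (x \<epsilon> 0) \<epsilon>)) \<in> O[at_right 0](\<lambda>\<epsilon>. \<epsilon> powr (5/2))"
    obtain a where a: "\<forall>\<^sub>F \<epsilon> in at_right 0. norm (norm (x \<epsilon> 0 - X \<epsilon> 0)) \<le> a * norm (\<epsilon> ^ 3)"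
      using w0 by (rule landau_o.bigE)
    obtain b where b: "\<forall>\<^sub>F \<epsilon> in at_right 0.
        norm (norm (y \<epsilon> 0 - Gamma2 f g \<gamma> (x \<epsilon> 0) \<epsilon>)) \<le> b * norm (\<epsilon> powr (5/2))"
      using z0 by (rule landau_o.bigE)
    have "\<forall>\<^sub>F \<epsilon> in at_right 0. \<epsilon> \<in> {0<..<\<epsilon>1}"
      by (rule eventually_at_rightI[OF _ C(2)])
    \<comment> \<open>The constant depends on T through exp(C T) but not on \<epsilon>;
      \<open>a\<close> and \<open>b\<close> are the constants of the two Landau hypotheses.\<close>
    then have "\<forall>\<^sub>F \<epsilon> in at_right 0. \<forall>t\<in>{0..T}.
        norm (x \<epsilon> t - X \<epsilon> t) \<le> sqrt (exp (C * T) * (a\<^sup>2 + 1 + b\<^sup>2 / \<beta>)) * \<epsilon>^3"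
      using sol a b
    proof eventually_elim
      case (elim \<epsilon>)
      show ?case
      proof
        fix t assume t: "t \<in> {0..T}"
        show "norm (x \<epsilon> t - X \<epsilon> t) \<le> sqrt (exp (C * T) * (a\<^sup>2 + 1 + b\<^sup>2 / \<beta>)) * \<epsilon>^3"
        proof (rule order_three_bound[OF C(1) \<beta>_pos _ t])
          show "(norm (x \<epsilon> t - X \<epsilon> t))\<^sup>2 \<le> exp (C * t) * ((norm (x \<epsilon> 0 - X \<epsilon> 0))\<^sup>2 + \<epsilon>^6
              + \<epsilon> / \<beta> * (norm (y \<epsilon> 0 - Gamma2 f g \<gamma> (x \<epsilon> 0) \<epsilon>))\<^sup>2)"
            using elim t by (intro est) auto
        qed (use elim in auto)
      qed
    qed
    then show "\<exists>M. \<forall>\<^sub>F \<epsilon> in at_right 0. \<forall>t\<in>{0..T}. norm (x \<epsilon> t - X \<epsilon> t) \<le> M * \<epsilon> ^ 3"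
      by blast
  qed
qed

end
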